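(* Let $r\ge 0$ be an integer and let $K$ be the Fredholm integral operator $(Kx)(s)=\int_0^1\kappa(s,t)x(t)\,dt$ with a Green's function type kernel $\kappa$. Assume $1$ is not an eigenvalue of $K$, let $f\in C[0,1]$, and suppose that the unique solution $\phi$ of $\phi-K\phi=f$ satisfies $\phi\in C^{2r+2}([0,1])$. Let $P_n$ be the interpolatory projection onto $X_n$ at the collocation points $\tau_j^k$, and set $K_n^M=P_nK+KP_n-P_nKP_n$. For all sufficiently large $n$, let $\phi_n^M$ be the unique solution of the modified collocation equation $\phi_n^M-K_n^M\phi_n^M=f$, and let $\tilde\phi_n^M=K\phi_n^M+f$ be the iterated modified collocation solution. Then, as $n\to\infty$ with $h=1/n$, $$\|\phi-\phi_n^M\|_\infty=\begin{cases}O(h^{2r+2}), & r\ge1,\\ O(h^3), & r=0,\end{cases}\qquad\text{and}\qquad \|\phi-\tilde\phi_n^M\|_\infty=\begin{cases}O(h^{2r+3}), & r\ge1,\\ O(h^4), & r=0.\end{cases}$$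
   Context: Kernel: $\Omega_1=\{(s,t):0\le t\le s\le 1\}$, $\Omega_2=\{(s,t):0\le s\le t\le 1\}$. A continuous function $\kappa:[0,1]\times[0,1]\to\mathbb{R}$ is of Green's function type if there are $\kappa_i\in C^\alpha(\Omega_i)$, $i=1,2$, with $\kappa=\kappa_1$ on $\Omega_1$, $\kappa=\kappa_2$ on $\Omega_2$, and $\kappa_1(s,s)=\kappa_2(s,s)$ for all $s\in[0,1]$. Here $\alpha$ is a positive integer with $\alpha>r$ when $r\ge1$, and it is assumed throughout that the partial derivatives $D^{(j,k)}\kappa_i=\partial^{j+k}\kappa_i/\partial s^j\partial t^k$, $j,k\in\{0,1,2\}$, exist and are continuous and bounded on $\Omega_i$. The formula for $K$ is used on $C[0,1]$ and also on $L^\infty[0,1]$. Approximation: for $n\ge1$ let $h=1/n$, $t_j=j/n$ ($0\le j\le n$), $\Delta_j=[t_{j-1},t_j]$, and let $X_n$ be the set of $x\in L^\infty[0,1]$ such that $x|_{\Delta_j}$ is a polynomial of degree $\le 2r$ for each $j=1,\dots,n$. The collocation points in $\Delta_j$ are $\tau_j^k=t_{j-1}+\frac{kh}{2r}$, $k=0,1,\dots,2r$, if $r\ge1$; if $r=0$ the single collocation point is the midpoint $\tau_j^0=\frac{t_{j-1}+t_j}{2}$. For $x\in C[0,1]$, $P_nx\in X_n$ is the function whose restriction to each $\Delta_j$ is the polynomial of degree $\le 2r$ interpolating $x$ at $\tau_j^0,\dots,\tau_j^{2r}$. Via the Hahn-Banach theorem, $P_n$ is extended to a projection $P_n:L^\infty[0,1]\to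 X_n$, with $\|P_n\|$ bounded uniformly in $n$. $\|\cdot\|_\infty$ is the sup norm on $[0,1]$. Constants in $O(\cdot)$ are independent of $h$. *)

theory Defs
  imports
    "HOL-Probability.Essential_Supremum"
    "HOL-Computational_Algebra.Polynomial"
    "HOL-Library.Landau_Symbols"
begin

abbreviation unit_leb :: "real measure"
  where "unit_leb \<equiv> lebesgue_on {0..1}"

definition ess_bounded :: "(real \<Rightarrow> real) \<Rightarrow> bool"
  where "ess_bounded x \<longleftrightarrow>
    x \<in> borel_measurable unit_leb \<and> (\<exists>C. AE t in unit_leb. \<bar>x t\<bar> \<le> C)"

definition linf_rel :: "(real \<Rightarrow> real) \<Rightarrow> (real \<Rightarrow> real) \<Rightarrow> bool"
  where "linf_rel x y \<longleftrightarrow> ess_bounded x \<and> ess_bounded y \<and> (AE t in unit_leb. x t = y t)"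

definition ess_norm :: "(real \<Rightarrow> real) \<Rightarrow> real"
  where "ess_norm x = real_of_ereal (esssup unit_leb (\<lambda>t. ereal \<bar>x t\<bar>))"

lemma emeasure_unit_leb: "emeasure unit_leb (space unit_leb) = 1"
  by (simp add: emeasure_restrict_space space_restrict_space)

lemma ess_bounded_const: "ess_bounded (\<lambda>_. c)"
  unfolding ess_bounded_def by auto

lemma ess_bounded_add:
  assumes "ess_bounded x" "ess_bounded y"
  shows "ess_bounded (\<lambda>t. x t + y t)"
proof -
  from assms obtain C D where "AE t in unit_leb. \<bar>x t\<bar> \<le> C" "AE t in unit_leb. \<bar>y t\<bar> \<le> D"
    unfolding ess_bounded_def by auto
  then have "AE t in unit_leb. \<bar>x t + y t\<bar> \<le> C + D"
    by eventually_elim linarith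
  with assms show ?thesis unfolding ess_bounded_def by auto
qed

lemma ess_bounded_scale:
  assumes "ess_bounded x"
  shows "ess_bounded (\<lambda>t. c * x t)"
proof -
  from assms obtain C where "AE t in unit_leb. \<bar>x t\<bar> \<le> C"
    unfolding ess_bounded_def by auto
  then have "AE t in unit_leb. \<bar>c * x t\<bar> \<le> \<bar>c\<bar> * C"
    by eventually_elim (simp add: abs_mult mult_left_mono)
  with assms show ?thesis unfolding ess_bounded_def by auto
qed

lemma ess_bounded_continuous:
  assumes "continuous_on {0..1} x"
  shows "ess_bounded x"
proof -
  have m: "x \<in> borel_measurable unit_leb"
    using assms by (intro continuous_imp_measurable_on_sets_lebesgue) auto
  have "bounded (x ` {0..1})"
    using assms by (intro compact_imp_bounded compact_continuous_image) auto
  then obtain C where "\<forall>t\<in>{0..1}. \<bar>x t\<bar> \<le> C"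
    unfolding bounded_iff by auto
  then have "AE t in unit_leb. \<bar>x t\<bar> \<le> C"
    by (intro AE_I2) (auto simp: space_restrict_space)
  with m show ?thesis unfolding ess_bounded_def by auto
qed

lemma esssup_abs_eq:
  assumes "ess_bounded x"
  shows "esssup unit_leb (\<lambda>t. ereal \<bar>x t\<bar>) = ereal (ess_norm x)" and "0 \<le> ess_norm x"
proof -
  let ?e = "esssup unit_leb (\<lambda>t. ereal \<bar>x t\<bar>)"
  have m: "(\<lambda>t. ereal \<bar>x t\<bar>) \<in> borel_measurable unit_leb"
    using assms unfolding ess_bounded_def by auto
  obtain C where C: "AE t in unit_leb. \<bar>x t\<bar> \<le> C"
    using assms unfolding ess_bounded_def by auto
  have "esssup unit_leb (\<lambda>_. 0::ereal) \<le> ?e"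
    by (rule esssup_mono) auto
  then have ge: "0 \<le> ?e"
    using esssup_const[of unit_leb "0::ereal"] emeasure_unit_leb by simp
  have "?e \<le> ereal C"
    using m C by (intro esssup_I) auto
  with ge have "\<bar>?e\<bar> \<noteq> \<infinity>" by auto
  then show "?e = ereal (ess_norm x)"
    unfolding ess_norm_def by (simp add: ereal_real)
  show "0 \<le> ess_norm x"
    unfolding ess_norm_def using ge by (rule real_of_ereal_pos)
qed

lemma AE_le_ess_norm:
  assumes "ess_bounded x"
  shows "AE t in unit_leb. \<bar>x t\<bar> \<le> ess_norm x"
  using esssup_AE[of "\<lambda>t. ereal \<bar>x t\<bar>" unit_leb] esssup_abs_eq(1)[OF assms] by simp

lemma ess_norm_le:
  assumes "ess_bounded x" "AE t in unit_leb. \<bar>x t\<bar> \<le> C"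
  shows "ess_norm x \<le> C"
proof -
  have m: "(\<lambda>t. ereal \<bar>x t\<bar>) \<in> borel_measurable unit_leb"
    using assms unfolding ess_bounded_def by auto
  have "esssup unit_leb (\<lambda>t. ereal \<bar>x t\<bar>) \<le> ereal C"
    using m assms by (intro esssup_I) auto
  then show ?thesis using esssup_abs_eq(1)[OF assms(1)] by simp
qed

lemma ess_norm_cong:
  assumes "linf_rel x y"
  shows "ess_norm x = ess_norm y"
proof (rule antisym)
  from assms have b: "ess_bounded x" "ess_bounded y" and e: "AE t in unit_leb. x t = y t"
    unfolding linf_rel_def by auto
  from AE_le_ess_norm[OF b(2)] e have "AE t in unit_leb. \<bar>x t\<bar> \<le> ess_norm y"
    by eventually_elim simp
  with b show "ess_norm x \<le> ess_norm y" by (intro ess_norm_le)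
  from AE_le_ess_norm[OF b(1)] e have "AE t in unit_leb. \<bar>y t\<bar> \<le> ess_norm x"
    by eventually_elim simp
  with b show "ess_norm y \<le> ess_norm x" by (intro ess_norm_le)
qed

lemma linf_part_equivp: "part_equivp linf_rel"
proof (rule part_equivpI)
  show "\<exists>x. linf_rel x x"
    using ess_bounded_const[of 0] unfolding linf_rel_def by auto
  show "symp linf_rel"
    unfolding linf_rel_def symp_def by auto
  show "transp linf_rel"
    unfolding linf_rel_def transp_def by auto
qed

text \<open>
  \<open>abs_linf\<close> sends an essentially bounded function on the unit interval to its class modulo equality
  almost everywhere (it is unspecified on other functions); \<open>rep_linf\<close> chooses a representative.
\<close>
quotient_type linf = "real \<Rightarrow> real" / partial: linf_rel
  by (rule linf_part_equivp)

instantiation linf :: real_normed_vector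
begin

lift_definition zero_linf :: linf is "\<lambda>_. 0"
  by (simp add: linf_rel_def ess_bounded_const)

lift_definition plus_linf :: "linf \<Rightarrow> linf \<Rightarrow> linf" is "\<lambda>x y t. x t + y t"
  unfolding linf_rel_def by (auto intro: ess_bounded_add)

lift_definition scaleR_linf :: "real \<Rightarrow> linf \<Rightarrow> linf" is "\<lambda>c x t. c * x t"
  unfolding linf_rel_def by (auto intro: ess_bounded_scale)

lift_definition norm_linf :: "linf \<Rightarrow> real" is ess_norm
  by (rule ess_norm_cong)

definition uminus_linf :: "linf \<Rightarrow> linf" where "- x = (-1) *\<^sub>R x" for x :: linf
definition minus_linf :: "linf \<Rightarrow> linf \<Rightarrow> linf" where "x - y = x + (- y)" for x y :: linf
definition dist_linf :: "linf \<Rightarrow> linf \<Rightarrow> real" where "dist x y = norm (x - y)" for x y :: linf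
definition sgn_linf :: "linf \<Rightarrow> linf" where "sgn x = inverse (norm x) *\<^sub>R x" for x :: linf
definition uniformity_linf :: "(linf \<times> linf) filter"
  where "uniformity_linf = (INF e\<in>{0<..}. principal {(x, y). dist x y < e})"
definition open_linf :: "linf set \<Rightarrow> bool"
  where "open_linf U \<longleftrightarrow> (\<forall>x\<in>U. \<forall>\<^sub>F (x', y) in uniformity. x' = x \<longrightarrow> y \<in> U)" for U :: "linf set"

instance
proof
  fix x y z :: linf and a b :: real and U :: "linf set"
  show "x + y + z = x + (y + z)"
    by transfer (auto simp: linf_rel_def add.assoc intro!: ess_bounded_add)
  show "x + y = y + x"
    by transfer (auto simp: linf_rel_def add.commute intro!: ess_bounded_add)
  show "0 + x = x"
    by transfer (auto simp: linf_rel_def)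
  show "- x + x = 0"
    unfolding uminus_linf_def
    by transfer (auto simp: linf_rel_def ess_bounded_const
        intro!: ess_bounded_add ess_bounded_scale[of _ "-1", simplified])
  show "x - y = x + - y"
    by (rule minus_linf_def)
  show "a *\<^sub>R (x + y) = a *\<^sub>R x + a *\<^sub>R y"
    by transfer (auto simp: linf_rel_def distrib_left intro!: ess_bounded_add ess_bounded_scale)
  show "(a + b) *\<^sub>R x = a *\<^sub>R x + b *\<^sub>R x"
    by transfer (auto simp: linf_rel_def distrib_right intro!: ess_bounded_add ess_bounded_scale)
  show "a *\<^sub>R b *\<^sub>R x = (a * b) *\<^sub>R x"
    by transfer (auto simp: linf_rel_def mult.assoc intro!: ess_bounded_scale)
  show "1 *\<^sub>R x = x"
    by transfer (auto simp: linf_rel_def)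
  show "dist x y = norm (x - y)"
    by (rule dist_linf_def)
  show "sgn x = inverse (norm x) *\<^sub>R x"
    by (rule sgn_linf_def)
  show "uniformity = (INF e\<in>{0<..}. principal {(x, y :: linf). dist x y < e})"
    by (rule uniformity_linf_def)
  show "open U \<longleftrightarrow> (\<forall>x\<in>U. \<forall>\<^sub>F (x', y) in uniformity. x' = x \<longrightarrow> y \<in> U)"
    by (rule open_linf_def)
  show "norm x = 0 \<longleftrightarrow> x = 0"
  proof (transfer, rule iffI)
    fix x assume x: "linf_rel x x" and "ess_norm x = 0"
    then show "linf_rel x (\<lambda>_. 0)"
      using AE_le_ess_norm[of x] by (auto simp: linf_rel_def ess_bounded_const)
  next
    fix x assume "linf_rel x (\<lambda>_. 0)"
    then have b: "ess_bounded x" and "AE t in unit_leb. x t = 0"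
      by (auto simp: linf_rel_def)
    then have "AE t in unit_leb. \<bar>x t\<bar> \<le> 0" by auto
    with b show "ess_norm x = 0"
      using ess_norm_le[of x 0] esssup_abs_eq(2)[of x] by auto
  qed
  show "norm (x + y) \<le> norm x + norm y"
  proof transfer
    fix x y assume "linf_rel x x" "linf_rel y y"
    then have b: "ess_bounded x" "ess_bounded y" by (auto simp: linf_rel_def)
    from AE_le_ess_norm[OF b(1)] AE_le_ess_norm[OF b(2)]
    have "AE t in unit_leb. \<bar>x t + y t\<bar> \<le> ess_norm x + ess_norm y"
      by eventually_elim linarith
    then show "ess_norm (\<lambda>t. x t + y t) \<le> ess_norm x + ess_norm y"
      by (intro ess_norm_le ess_bounded_add b)
  qed
  show "norm (a *\<^sub>R x) = \<bar>a\<bar> * norm x"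
  proof transfer
    fix a x assume "linf_rel x x"
    then have b: "ess_bounded x" by (auto simp: linf_rel_def)
    have le: "ess_norm (\<lambda>t. c * y t) \<le> \<bar>c\<bar> * ess_norm y" if "ess_bounded y" for c y
    proof -
      from AE_le_ess_norm[OF that] have "AE t in unit_leb. \<bar>c * y t\<bar> \<le> \<bar>c\<bar> * ess_norm y"
        by eventually_elim (simp add: abs_mult mult_left_mono)
      then show ?thesis by (intro ess_norm_le ess_bounded_scale that)
    qed
    show "ess_norm (\<lambda>t. a * x t) = \<bar>a\<bar> * ess_norm x"
    proof (cases "a = 0")
      case True
      then show ?thesis
        using le[OF b, of 0] esssup_abs_eq(2)[OF ess_bounded_scale[OF b, of 0]] by simp
    next
      case False
      have "ess_norm x = ess_norm (\<lambda>t. inverse a * (a * x t))"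
        using False by (simp add: mult.assoc[symmetric])
      also have "\<dots> \<le> \<bar>inverse a\<bar> * ess_norm (\<lambda>t. a * x t)"
        by (rule le) (rule ess_bounded_scale[OF b])
      finally have "\<bar>a\<bar> * ess_norm x \<le> ess_norm (\<lambda>t. a * x t)"
        using False by (simp add: field_simps abs_inverse)
      with le[OF b, of a] show ?thesis by simp
    qed
  qed
qed

end

lemma norm_abs_linf_continuous:
  assumes "continuous_on {0..1} x"
  shows "norm (abs_linf x) = (SUP t\<in>{0..1}. \<bar>x t\<bar>)"
proof -
  have b: "ess_bounded x" by (rule ess_bounded_continuous[OF assms])
  then have "norm (abs_linf x) = ess_norm x"
    by (simp add: norm_linf.abs_eq linf_rel_def)
  moreover have "bdd_above ((\<lambda>t. \<bar>x t\<bar>) ` {0..1})"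
    using assms by (intro compact_imp_bounded[THEN bounded_imp_bdd_above]
        compact_continuous_image continuous_intros) auto
  then have "ess_norm x \<le> (SUP t\<in>{0..1}. \<bar>x t\<bar>)"
    by (intro ess_norm_le[OF b] AE_I2 cSUP_upper) (auto simp: space_restrict_space)
  moreover have "(SUP t\<in>{0..1}. \<bar>x t\<bar>) \<le> ess_norm x"
  proof (rule cSUP_least)
    fix t :: real assume t: "t \<in> {0..1}"
    let ?A = "{t \<in> {0..1}. ess_norm x < \<bar>x t\<bar>}"
    show "\<bar>x t\<bar> \<le> ess_norm x"
    proof (rule ccontr)
      assume "\<not> \<bar>x t\<bar> \<le> ess_norm x"
      then have tA: "t \<in> ?A" using t by auto
      have "continuous_on {0..1} (\<lambda>t. \<bar>x t\<bar>)"
        using assms by (intro continuous_intros)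
      then obtain d where d: "d > 0"
        and near: "\<And>s. s \<in> {0..1} \<Longrightarrow> dist s t < d \<Longrightarrow> dist \<bar>x s\<bar> \<bar>x t\<bar> < \<bar>x t\<bar> - ess_norm x"
        using tA t unfolding continuous_on_iff by (metis (no_types, lifting) diff_gt_0_iff_gt mem_Collect_eq)
      define a where "a = max 0 (t - d / 2)"
      define c where "c = min 1 (t + d / 2)"
      have ac: "a < c" using t d by (auto simp: a_def c_def)
      have sub: "{a..c} \<subseteq> ?A"
      proof
        fix s assume s: "s \<in> {a..c}"
        then have s01: "s \<in> {0..1}" by (auto simp: a_def c_def)
        from s d have "dist s t < d" by (auto simp: a_def c_def dist_real_def)
        from near[OF s01 this] s01 show "s \<in> ?A" by (auto simp: dist_real_def)
      qed
      have "AE s in lebesgue. s \<in> {0..1} \<longrightarrow> \<bar>x s\<bar> \<le> ess_norm x"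
        using AE_le_ess_norm[OF b] by (simp add: AE_restrict_space_iff)
      then have "AE s in lebesgue. s \<notin> {a..c}"
        by eventually_elim (use sub in force)
      then have "{a..c} \<in> null_sets lebesgue"
        by (subst AE_iff_null_sets) auto
      then show False using ac by (auto simp: null_sets_def)
    qed
  qed auto
  ultimately show ?thesis by simp
qed

definition Ck_on_unit :: "nat \<Rightarrow> (real \<Rightarrow> real) \<Rightarrow> bool"
  where "Ck_on_unit k x \<longleftrightarrow> (\<exists>D :: nat \<Rightarrow> real \<Rightarrow> real.
    (\<forall>s\<in>{0..1}. D 0 s = x s) \<and>
    (\<forall>i<k. \<forall>s\<in>{0..1}. (D i has_real_derivative D (Suc i) s) (at s within {0..1})) \<and>
    (\<forall>i\<le>k. continuous_on {0..1} (D i)))"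

definition Omega1 :: "(real \<times> real) set"
  where "Omega1 = {(s, t). 0 \<le> t \<and> t \<le> s \<and> s \<le> 1}"

definition Omega2 :: "(real \<times> real) set"
  where "Omega2 = {(s, t). 0 \<le> s \<and> s \<le> t \<and> t \<le> 1}"

text \<open>
  The partial derivatives \<open>D j k\<close> of \<open>g\<close> (\<open>j\<close> times in the first and \<open>k\<close> times in the second variable)
  with \<open>(j, k) \<in> I\<close> exist and are continuous and bounded on \<open>\<Omega>\<close>. Derivatives are taken relative to
  \<open>\<Omega>\<close>, hence are one-sided at boundary points. At the two corners of a triangle where one of the
  slices is a single point, the derivative along that slice is determined by continuity.
  The set \<open>I\<close> should be closed under decreasing either index.
\<close>
definition partials_on :: "(nat \<times> nat) set \<Rightarrow> (real \<times> real) set \<Rightarrow> (real \<Rightarrow> real \<Rightarrow> real) \<Rightarrow> bool"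
  where "partials_on I \<Omega> g \<longleftrightarrow> (\<exists>D :: nat \<Rightarrow> nat \<Rightarrow> real \<Rightarrow> real \<Rightarrow> real.
    (\<forall>(s, t)\<in>\<Omega>. D 0 0 s t = g s t) \<and>
    (\<forall>j k. (Suc j, k) \<in> I \<longrightarrow> (\<forall>(s, t)\<in>\<Omega>.
      ((\<lambda>u. D j k u t) has_real_derivative D (Suc j) k s t) (at s within {u. (u, t) \<in> \<Omega>}))) \<and>
    (\<forall>j k. (j, Suc k) \<in> I \<longrightarrow> (\<forall>(s, t)\<in>\<Omega>.
      ((\<lambda>u. D j k s u) has_real_derivative D j (Suc k) s t) (at t within {u. (s, u) \<in> \<Omega>}))) \<and>
    (\<forall>(j, k)\<in>I. continuous_on \<Omega> (\<lambda>(s, t). D j k s t) \<and> bounded ((\<lambda>(s, t). D j k s t) ` \<Omega>)))"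

definition C_on :: "nat \<Rightarrow> (real \<times> real) set \<Rightarrow> (real \<Rightarrow> real \<Rightarrow> real) \<Rightarrow> bool"
  where "C_on \<alpha> \<Omega> g \<longleftrightarrow> partials_on {(j, k). j + k \<le> \<alpha>} \<Omega> g"

definition green_type :: "nat \<Rightarrow> (real \<Rightarrow> real \<Rightarrow> real) \<Rightarrow> bool"
  where "green_type \<alpha> \<kappa> \<longleftrightarrow>
    continuous_on ({0..1} \<times> {0..1}) (\<lambda>(s, t). \<kappa> s t) \<and>
    (\<exists>\<kappa>\<^sub>1 \<kappa>\<^sub>2.
      C_on \<alpha> Omega1 \<kappa>\<^sub>1 \<and> C_on \<alpha> Omega2 \<kappa>\<^sub>2 \<and>
      (\<forall>(s, t)\<in>Omega1. \<kappa> s t = \<kappa>\<^sub>1 s t) \<and> (\<forall>(s, t)\<in>Omega2. \<kappa> s t = \<kappa>\<^sub>2 s t) \<and>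
      (\<forall>s\<in>{0..1}. \<kappa>\<^sub>1 s s = \<kappa>\<^sub>2 s s) \<and>
      partials_on ({0..2} \<times> {0..2}) Omega1 \<kappa>\<^sub>1 \<and> partials_on ({0..2} \<times> {0..2}) Omega2 \<kappa>\<^sub>2)"

definition fredholm :: "(real \<Rightarrow> real \<Rightarrow> real) \<Rightarrow> (real \<Rightarrow> real) \<Rightarrow> real \<Rightarrow> real"
  where "fredholm \<kappa> x s = (\<integral>t. \<kappa> s t * x t \<partial>unit_leb)"

definition fredholm_linf :: "(real \<Rightarrow> real \<Rightarrow> real) \<Rightarrow> linf \<Rightarrow> linf"
  where "fredholm_linf \<kappa> x = abs_linf (fredholm \<kappa> (rep_linf x))"

definition eigenvalue_of :: "('a::real_vector \<Rightarrow> 'a) \<Rightarrow> real \<Rightarrow> bool"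
  where "eigenvalue_of T c \<longleftrightarrow> (\<exists>x. x \<noteq> 0 \<and> T x = c *\<^sub>R x)"

definition cell :: "nat \<Rightarrow> nat \<Rightarrow> real set"
  where "cell n j = {(real j - 1) / real n .. real j / real n}"

definition colloc_pt :: "nat \<Rightarrow> nat \<Rightarrow> nat \<Rightarrow> nat \<Rightarrow> real"
  where "colloc_pt r n j k =
    (if r = 0 then ((real j - 1) / real n + real j / real n) / 2
     else (real j - 1) / real n + real k * (1 / real n) / (2 * real r))"

definition pw_poly_space :: "nat \<Rightarrow> nat \<Rightarrow> linf set"
  where "pw_poly_space r n = {x. \<forall>j\<in>{1..n}. \<exists>p :: real poly. degree p \<le> 2 * r \<and>
    (AE t in unit_leb. t \<in> cell n j \<longrightarrow> rep_linf x t = poly p t)}"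

definition is_interpolant :: "nat \<Rightarrow> nat \<Rightarrow> (real \<Rightarrow> real) \<Rightarrow> linf \<Rightarrow> bool"
  where "is_interpolant r n x y \<longleftrightarrow> (\<forall>j\<in>{1..n}. \<exists>p :: real poly. degree p \<le> 2 * r \<and>
    (\<forall>k\<le>2 * r. poly p (colloc_pt r n j k) = x (colloc_pt r n j k)) \<and>
    (AE t in unit_leb. t \<in> cell n j \<longrightarrow> rep_linf y t = poly p t))"

text \<open>
  The Hahn-Banach extension of the interpolation operators from the continuous functions is not
  unique, so only its characteristic properties are demanded: bounded linear projections onto the spaces of
  piecewise polynomials, extending interpolation, with uniformly bounded operator norms.
\<close>
definition interp_projections :: "nat \<Rightarrow> (nat \<Rightarrow> linf \<Rightarrow>\<^sub>L linf) \<Rightarrow> bool"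
  where "interp_projections r P \<longleftrightarrow>
    (\<forall>n\<ge>1. range (P n) \<subseteq> pw_poly_space r n \<and>
       (\<forall>x\<in>pw_poly_space r n. P n x = x) \<and>
       (\<forall>x. continuous_on {0..1} x \<longrightarrow> is_interpolant r n x (P n (abs_linf x)))) \<and>
    (\<exists>M. \<forall>n\<ge>1. norm (P n) \<le> M)"

definition mod_colloc_op :: "(linf \<Rightarrow> linf) \<Rightarrow> (linf \<Rightarrow> linf) \<Rightarrow> linf \<Rightarrow> linf"
  where "mod_colloc_op K Q x = Q (K x) + K (Q x) - Q (K (Q x))"

definition mod_colloc_sol :: "(linf \<Rightarrow> linf) \<Rightarrow> (linf \<Rightarrow> linf) \<Rightarrow> linf \<Rightarrow> linf"
  where "mod_colloc_sol K Q f = (THE x. x - mod_colloc_op K Q x = f)"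

definition iter_mod_colloc_sol :: "(linf \<Rightarrow> linf) \<Rightarrow> (linf \<Rightarrow> linf) \<Rightarrow> linf \<Rightarrow> linf"
  where "iter_mod_colloc_sol K Q f = K (mod_colloc_sol K Q f) + f"

end

theory Submission
  imports Defs "HOL-Complex_Analysis.Great_Picard"
begin

text \<open>
  Write \<open>K\<^sub>n\<close> for the modified collocation operator, \<open>Q = P\<^sub>n\<close> and \<open>h = 1 / n\<close>. Everything rests on
  \<open>K - K\<^sub>n = (I - Q) K (I - Q)\<close>. The integral operator smooths, so \<open>(I - Q) K\<close> has norm \<open>O(h)\<close>, and \<open>K\<^sub>n\<close>
  inherits from \<open>K\<close> the estimate \<open>\<parallel>x\<parallel> \<le> c \<parallel>x - K\<^sub>n x\<parallel>\<close>; as \<open>K\<^sub>n\<close> has finite rank, this gives unique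
  solvability. The error \<open>e = \<phi> - \<phi>\<^sub>n\<close> satisfies \<open>e - K\<^sub>n e = (I - Q) K (I - Q) \<phi>\<close>, and the iterated error is
  \<open>K e\<close>, where \<open>(I - K) e = (I - Q) K (I - Q) (\<phi> - e)\<close>.

  For \<open>r \<ge> 1\<close> piecewise linear functions belong to \<open>X\<^sub>n\<close>, hence \<open>(I - Q) K\<close> is even \<open>O(h\<^sup>2)\<close>, while
  \<open>(I - Q) \<phi>\<close> is \<open>O(h ^ (2 * r + 1))\<close>; so both errors are \<open>O(h ^ (2 * r + 3))\<close>. For \<open>r = 0\<close> the extra powers
  come from symmetry about the cell midpoints \<open>m\<close>: \<open>g = K (I - Q) \<phi>\<close> satisfies \<open>g s - g m = O(h\<^sup>3)\<close> and
  \<open>g (m + v) + g (m - v) - 2 g m = O(h ^ 4)\<close>, the latter because the second difference of a kernel with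
  a kink on the diagonal is even about \<open>m\<close> up to \<open>O(h\<^sup>2)\<close>. Integrating once more against the kernel
  yields \<open>K (I - Q) g = O(h ^ 4)\<close>.
\<close>

section \<open>Kernels of Green's function type\<close>

text \<open>The mean value inequality is applied twice: first to \<open>f'\<close>, then on the
  segment from \<open>x\<close> to \<open>y\<close> to \<open>f\<close> minus its linear part, whose
  derivative is \<open>f' z - f' x\<close>. This costs the factor 1/2 of the sharp constant.
  Derivatives are taken within \<open>S\<close> because the kernel pieces live on closed
  triangles.\<close>

lemma taylor1_bound:
  fixes f f' f'' :: "real \<Rightarrow> real"
  assumes S: "convex S"
    and f: "\<And>z. z \<in> S \<Longrightarrow> (f has_real_derivative f' z) (at z within S)"
    and f': "\<And>z. z \<in> S \<Longrightarrow> (f' has_real_derivative f'' z) (at z within S)"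
    and B: "\<And>z. z \<in> S \<Longrightarrow> \<bar>f'' z\<bar> \<le> B"
    and xy: "x \<in> S" "y \<in> S"
  shows "\<bar>f y - f x - f' x * (y - x)\<bar> \<le> B * (y - x)\<^sup>2"
proof -
  let ?T = "closed_segment x y"
  have T: "?T \<subseteq> S" using S xy by (simp add: closed_segment_subset)
  have B0: "0 \<le> B" using B[OF xy(1)] by linarith
  have lip: "\<bar>f' z - f' x\<bar> \<le> B * \<bar>y - x\<bar>" if z: "z \<in> ?T" for z
  proof -
    have "norm (f' z - f' x) \<le> B * norm (z - x)"
      using z T xy B f' by (intro field_differentiable_bound[OF S]) auto
    also have "\<dots> \<le> B * \<bar>y - x\<bar>"
      using z B0 by (intro mult_left_mono) (auto simp: closed_segment_eq_real_ivl split: if_splits)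
    finally show ?thesis by simp
  qed
  have "norm ((f y - f' x * y) - (f x - f' x * x)) \<le> (B * \<bar>y - x\<bar>) * norm (y - x)"
  proof (rule field_differentiable_bound[where S = ?T and f' = "\<lambda>z. f' z - f' x"])
    fix z assume z: "z \<in> ?T"
    have "(f has_real_derivative f' z) (at z within ?T)"
      using f[of z] z T by (meson DERIV_subset subsetD)
    then show "((\<lambda>z. f z - f' x * z) has_real_derivative f' z - f' x) (at z within ?T)"
      by (auto intro!: derivative_eq_intros)
  qed (use lip in auto)
  moreover have "(B * \<bar>y - x\<bar>) * norm (y - x) = B * (y - x)\<^sup>2"
    by (simp add: power2_eq_square)
  moreover have "(f y - f' x * y) - (f x - f' x * x) = f y - f x - f' x * (y - x)"
    by (simp add: algebra_simps)
  ultimately show ?thesis by (simp only: real_norm_def)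
qed

text \<open>Common abstraction of the two triangles, with \<open>D j k\<close> the mixed partial
  derivatives. Convexity of the slices is enough because every estimate moves along one variable at
  a time.\<close>

locale smooth_piece =
  fixes D :: "nat \<Rightarrow> nat \<Rightarrow> real \<Rightarrow> real \<Rightarrow> real" and \<Omega> :: "(real \<times> real) set" and C :: real
  assumes convex_fst: "\<And>t. convex {s. (s, t) \<in> \<Omega>}"
    and convex_snd: "\<And>s. convex {t. (s, t) \<in> \<Omega>}"
    and deriv_fst: "\<And>j k s t. j < 2 \<Longrightarrow> k \<le> 2 \<Longrightarrow> (s, t) \<in> \<Omega> \<Longrightarrow>
      ((\<lambda>u. D j k u t) has_real_derivative D (Suc j) k s t) (at s within {u. (u, t) \<in> \<Omega>})"
    and deriv_snd: "\<And>j k s t. j \<le> 2 \<Longrightarrow> k < 2 \<Longrightarrow> (s, t) \<in> \<Omega> \<Longrightarrow>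
      ((\<lambda>u. D j k s u) has_real_derivative D j (Suc k) s t) (at t within {u. (s, u) \<in> \<Omega>})"
    and bound: "\<And>j k s t. j \<le> 2 \<Longrightarrow> k \<le> 2 \<Longrightarrow> (s, t) \<in> \<Omega> \<Longrightarrow> \<bar>D j k s t\<bar> \<le> C"
begin

section \<open>Difference estimates on one smooth piece\<close>

lemma lipschitz_fst:
  assumes "j < 2" "k \<le> 2" "(s, t) \<in> \<Omega>" "(s', t) \<in> \<Omega>"
  shows "\<bar>D j k s t - D j k s' t\<bar> \<le> C * \<bar>s - s'\<bar>"
proof -
  have "norm (D j k s t - D j k s' t) \<le> C * norm (s - s')"
    using assms by (intro field_differentiable_bound[OF convex_fst[of t] deriv_fst]) (auto intro: bound)
  then show ?thesis by simp
qed

lemma lipschitz_snd: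
  assumes "j \<le> 2" "k < 2" "(s, t) \<in> \<Omega>" "(s, t') \<in> \<Omega>"
  shows "\<bar>D j k s t - D j k s t'\<bar> \<le> C * \<bar>t - t'\<bar>"
proof -
  have "norm (D j k s t - D j k s t') \<le> C * norm (t - t')"
    using assms by (intro field_differentiable_bound[OF convex_snd[of s] deriv_snd]) (auto intro: bound)
  then show ?thesis by simp
qed

text \<open>Mean value inequality in the first variable for the difference of the slices at
  \<open>t\<close> and \<open>t'\<close>: its derivative is a difference of \<open>D 1 0\<close>,
  which is Lipschitz in the second variable. All four corners are required so that both slices
  contain \<open>s\<close> and \<open>s'\<close>.\<close>

lemma mixed_difference:
  assumes "(s, t) \<in> \<Omega>" "(s', t) \<in> \<Omega>" "(s, t') \<in> \<Omega>" "(s', t') \<in> \<Omega>"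
  shows "\<bar>D 0 0 s t - D 0 0 s' t - D 0 0 s t' + D 0 0 s' t'\<bar> \<le> C * \<bar>s - s'\<bar> * \<bar>t - t'\<bar>"
proof -
  let ?S = "{u. (u, t) \<in> \<Omega>} \<inter> {u. (u, t') \<in> \<Omega>}"
  have "norm ((D 0 0 s t - D 0 0 s t') - (D 0 0 s' t - D 0 0 s' t')) \<le> (C * \<bar>t - t'\<bar>) * norm (s - s')"
  proof (rule field_differentiable_bound[where S = ?S and f' = "\<lambda>z. D 1 0 z t - D 1 0 z t'"])
    show "convex ?S" by (intro convex_Int convex_fst)
    fix z assume z: "z \<in> ?S"
    have "((\<lambda>u. D 0 0 u t) has_real_derivative D 1 0 z t) (at z within ?S)"
      "((\<lambda>u. D 0 0 u t') has_real_derivative D 1 0 z t') (at z within ?S)"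
      using deriv_fst[of 0 0 z t] deriv_fst[of 0 0 z t'] z by (auto intro: DERIV_subset)
    then show "((\<lambda>u. D 0 0 u t - D 0 0 u t') has_real_derivative D 1 0 z t - D 1 0 z t') (at z within ?S)"
      by (intro derivative_intros)
    show "norm (D 1 0 z t - D 1 0 z t') \<le> C * \<bar>t - t'\<bar>"
      using lipschitz_snd[of 1 0 z t t'] z by auto
  qed (use assms in auto)
  then show ?thesis by (simp add: algebra_simps)
qed

lemma taylor_fst:
  assumes "k \<le> 2" "(x, t) \<in> \<Omega>" "(y, t) \<in> \<Omega>"
  shows "\<bar>D 0 k y t - D 0 k x t - D 1 k x t * (y - x)\<bar> \<le> C * (y - x)\<^sup>2"
  by (rule taylor1_bound[OF convex_fst[of t], where f'' = "\<lambda>z. D 2 k z t"])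
    (use assms deriv_fst[of 0 k] deriv_fst[of 1 k] bound[of 2 k] in \<open>auto simp: numeral_2_eq_2\<close>)

lemma taylor_snd:
  assumes "j \<le> 2" "(s, x) \<in> \<Omega>" "(s, y) \<in> \<Omega>"
  shows "\<bar>D j 0 s y - D j 0 s x - D j 1 s x * (y - x)\<bar> \<le> C * (y - x)\<^sup>2"
  by (rule taylor1_bound[OF convex_snd[of s], where f'' = "\<lambda>z. D j 2 s z"])
    (use assms deriv_snd[of j 0] deriv_snd[of j 1] bound[of j 2] in \<open>auto simp: numeral_2_eq_2\<close>)

text \<open>The Taylor remainder in the first variable is Lipschitz in the second: the difference of
  two slices has second derivative \<open>D 2 0 z t - D 2 0 z t'\<close>, controlled by
  \<open>D 2 1\<close>.\<close>

lemma taylor_fst_difference: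
  assumes "(x, t) \<in> \<Omega>" "(y, t) \<in> \<Omega>" "(x, t') \<in> \<Omega>" "(y, t') \<in> \<Omega>"
  shows "\<bar>(D 0 0 y t - D 0 0 x t - D 1 0 x t * (y - x))
    - (D 0 0 y t' - D 0 0 x t' - D 1 0 x t' * (y - x))\<bar> \<le> C * \<bar>t - t'\<bar> * (y - x)\<^sup>2"
proof -
  let ?S = "{u. (u, t) \<in> \<Omega>} \<inter> {u. (u, t') \<in> \<Omega>}"
  have d: "((\<lambda>u. D j 0 u t - D j 0 u t') has_real_derivative D (Suc j) 0 z t - D (Suc j) 0 z t') (at z within ?S)"
    if "z \<in> ?S" "j < 2" for z j
  proof -
    have "((\<lambda>u. D j 0 u t) has_real_derivative D (Suc j) 0 z t) (at z within ?S)"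
      "((\<lambda>u. D j 0 u t') has_real_derivative D (Suc j) 0 z t') (at z within ?S)"
      using deriv_fst[of j 0 z t] deriv_fst[of j 0 z t'] that by (auto intro: DERIV_subset)
    then show ?thesis by (intro derivative_intros)
  qed
  have "\<bar>(D 0 0 y t - D 0 0 y t') - (D 0 0 x t - D 0 0 x t') - (D 1 0 x t - D 1 0 x t') * (y - x)\<bar>
    \<le> (C * \<bar>t - t'\<bar>) * (y - x)\<^sup>2"
  proof (rule taylor1_bound[where S = ?S and f'' = "\<lambda>z. D 2 0 z t - D 2 0 z t'"])
    show "convex ?S" by (intro convex_Int convex_fst)
    show "\<bar>D 2 0 z t - D 2 0 z t'\<bar> \<le> C * \<bar>t - t'\<bar>" if "z \<in> ?S" for z
      using lipschitz_snd[of 2 0 z t t'] that by auto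
  qed (use assms d[of _ 0] d[of _ 1] in \<open>auto simp: numeral_2_eq_2\<close>)
  then show ?thesis by (simp add: algebra_simps)
qed

lemma second_difference_fst:
  assumes "(m, t) \<in> \<Omega>" "(m + v, t) \<in> \<Omega>" "(m - v, t) \<in> \<Omega>"
  shows "\<bar>D 0 0 (m + v) t + D 0 0 (m - v) t - 2 * D 0 0 m t\<bar> \<le> 2 * C * v\<^sup>2"
  using taylor_fst[of 0 m t "m + v"] taylor_fst[of 0 m t "m - v"] assms by simp

lemma second_difference_fst_lipschitz:
  assumes "(m, t) \<in> \<Omega>" "(m + v, t) \<in> \<Omega>" "(m - v, t) \<in> \<Omega>"
    and "(m, t') \<in> \<Omega>" "(m + v, t') \<in> \<Omega>" "(m - v, t') \<in> \<Omega>"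
  shows "\<bar>(D 0 0 (m + v) t + D 0 0 (m - v) t - 2 * D 0 0 m t)
    - (D 0 0 (m + v) t' + D 0 0 (m - v) t' - 2 * D 0 0 m t')\<bar> \<le> 2 * C * v\<^sup>2 * \<bar>t - t'\<bar>"
  using taylor_fst_difference[of m t "m + v" t'] taylor_fst_difference[of m t "m - v" t'] assms
  by (simp add: algebra_simps)

text \<open>Interpolation reproduces affine functions. After expanding at \<open>a\<close> only the
  Taylor remainder at \<open>s\<close> and a fraction of the remainder at \<open>b\<close>
  survive.\<close>

lemma linear_interpolation_fst:
  assumes "(a, t) \<in> \<Omega>" "(b, t) \<in> \<Omega>" "a \<le> s" "s \<le> b" "a < b"
  shows "\<bar>D 0 0 s t - ((b - s) * D 0 0 a t + (s - a) * D 0 0 b t) / (b - a)\<bar> \<le> 2 * C * (b - a)\<^sup>2"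
proof -
  have C0: "0 \<le> C" using bound[of 0 0 a t] assms(1) by simp
  have "s \<in> closed_segment a b" using assms by (auto simp: closed_segment_eq_real_ivl)
  then have s: "(s, t) \<in> \<Omega>"
    using closed_segment_subset[OF _ _ convex_fst[of t], of a b] assms by auto
  let ?R = "\<lambda>y. D 0 0 y t - D 0 0 a t - D 1 0 a t * (y - a)"
  have "(s - a)\<^sup>2 \<le> (b - a)\<^sup>2" using assms by (intro power_mono) auto
  then have 1: "\<bar>?R s\<bar> \<le> C * (b - a)\<^sup>2"
    using taylor_fst[of 0 a t s] s assms(1) mult_left_mono[OF _ C0] by (meson le0 order_trans)
  have 2: "\<bar>?R b\<bar> \<le> C * (b - a)\<^sup>2"
    using taylor_fst[of 0 a t b] assms by simp
  let ?q = "(s - a) / (b - a)"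
  have q: "0 \<le> ?q" "?q \<le> 1" using assms by auto
  have eq: "D 0 0 s t - ((b - s) * D 0 0 a t + (s - a) * D 0 0 b t) / (b - a) = ?R s - ?q * ?R b"
    using assms(5) by (simp add: divide_simps) (simp add: algebra_simps)
  have "\<bar>?q * ?R b\<bar> = ?q * \<bar>?R b\<bar>"
    by (simp only: abs_mult abs_of_nonneg[OF q(1)])
  also have "\<dots> \<le> 1 * (C * (b - a)\<^sup>2)"
    using q 2 by (intro mult_mono) auto
  finally have "\<bar>?q * ?R b\<bar> \<le> C * (b - a)\<^sup>2" by simp
  from add_mono[OF 1 this] show ?thesis
    unfolding eq by (intro order_trans[OF abs_triangle_ineq4]) simp
qed

text \<open>The point is reached from \<open>(m, m)\<close> along an L-shaped path, whose corner
  must lie in the piece; hence the disjunction. Each leg costs a second-order remainder, and moving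
  the derivative from the corner back to \<open>(m, m)\<close> costs a third term of the same
  size.\<close>

lemma taylor_corner:
  assumes "(m, m) \<in> \<Omega>" "(m + s, m + t) \<in> \<Omega>" "(m + s, m) \<in> \<Omega> \<or> (m, m + t) \<in> \<Omega>"
    and "\<bar>s\<bar> \<le> d" "\<bar>t\<bar> \<le> d"
  shows "\<bar>D 0 0 (m + s) (m + t) - D 0 0 m m - D 1 0 m m * s - D 0 1 m m * t\<bar> \<le> 3 * C * d\<^sup>2"
proof -
  have C0: "0 \<le> C" using bound[of 0 0 m m] assms(1) by simp
  have sq: "C * s\<^sup>2 \<le> C * d\<^sup>2" "C * t\<^sup>2 \<le> C * d\<^sup>2"
    using assms(4,5) C0 by (auto intro!: mult_left_mono abs_le_square_iff[THEN iffD1])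
  have st: "C * \<bar>s\<bar> * \<bar>t\<bar> \<le> C * d\<^sup>2"
    using assms(4,5) C0 by (auto intro!: mult_left_mono mult_mono simp: power2_eq_square mult.assoc)
  from assms(3) show ?thesis
  proof
    assume i: "(m + s, m) \<in> \<Omega>"
    have 1: "\<bar>D 0 0 (m + s) m - D 0 0 m m - D 1 0 m m * s\<bar> \<le> C * s\<^sup>2"
      using taylor_fst[of 0 m m "m + s"] i assms by simp
    have 2: "\<bar>D 0 0 (m + s) (m + t) - D 0 0 (m + s) m - D 0 1 (m + s) m * t\<bar> \<le> C * t\<^sup>2"
      using taylor_snd[of 0 "m + s" m "m + t"] i assms by simp
    have "\<bar>(D 0 1 (m + s) m - D 0 1 m m) * t\<bar> \<le> C * \<bar>s\<bar> * \<bar>t\<bar>"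
      using lipschitz_fst[of 0 1 "m + s" m m] i assms by (auto simp: abs_mult intro: mult_right_mono)
    then show ?thesis using 1 2 sq st unfolding left_diff_distrib by linarith
  next
    assume i: "(m, m + t) \<in> \<Omega>"
    have 1: "\<bar>D 0 0 m (m + t) - D 0 0 m m - D 0 1 m m * t\<bar> \<le> C * t\<^sup>2"
      using taylor_snd[of 0 m m "m + t"] i assms by simp
    have 2: "\<bar>D 0 0 (m + s) (m + t) - D 0 0 m (m + t) - D 1 0 m (m + t) * s\<bar> \<le> C * s\<^sup>2"
      using taylor_fst[of 0 m "m + t" "m + s"] i assms by simp
    have "\<bar>(D 1 0 m (m + t) - D 1 0 m m) * s\<bar> \<le> C * \<bar>t\<bar> * \<bar>s\<bar>"
      using lipschitz_snd[of 1 0 m "m + t" m] i assms by (auto simp: abs_mult intro: mult_right_mono)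
    then show ?thesis using 1 2 sq st unfolding left_diff_distrib
      by (simp add: mult.commute mult.left_commute)
  qed
qed

end

lemma smooth_piece_mono:
  assumes "smooth_piece D \<Omega> C" "C \<le> C'"
  shows "smooth_piece D \<Omega> C'"
proof -
  interpret smooth_piece D \<Omega> C by fact
  show ?thesis
    using convex_fst convex_snd deriv_fst deriv_snd order_trans[OF bound assms(2)]
    by unfold_locales auto
qed

lemma smooth_piece_exists:
  assumes "partials_on ({0..2} \<times> {0..2}) \<Omega> g"
    and "\<And>t. convex {s. (s, t) \<in> \<Omega>}" "\<And>s. convex {t. (s, t) \<in> \<Omega>}"
  obtains D C where "smooth_piece D \<Omega> C" "\<And>s t. (s, t) \<in> \<Omega> \<Longrightarrow> D 0 0 s t = g s t"
proof -
  obtain D where D0: "\<forall>(s, t)\<in>\<Omega>. D 0 0 s t = g s t"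
    and D1: "\<forall>j k. (Suc j, k) \<in> {0..2} \<times> {0..2} \<longrightarrow> (\<forall>(s, t)\<in>\<Omega>.
      ((\<lambda>u. D j k u t) has_real_derivative D (Suc j) k s t) (at s within {u. (u, t) \<in> \<Omega>}))"
    and D2: "\<forall>j k. (j, Suc k) \<in> {0..2} \<times> {0..2} \<longrightarrow> (\<forall>(s, t)\<in>\<Omega>.
      ((\<lambda>u. D j k s u) has_real_derivative D j (Suc k) s t) (at t within {u. (s, u) \<in> \<Omega>}))"
    and D3: "\<forall>(j, k)\<in>{0..2} \<times> {0..2}. continuous_on \<Omega> (\<lambda>(s, t). D j k s t) \<and> bounded ((\<lambda>(s, t). D j k s t) ` \<Omega>)"
    using assms(1) unfolding partials_on_def by auto
  have "\<exists>c. \<forall>(s, t)\<in>\<Omega>. \<bar>D j k s t\<bar> \<le> c" if "j \<le> 2" "k \<le> 2" for j k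
    using D3 that unfolding bounded_iff by fastforce
  then obtain c where c: "\<And>j k s t. j \<le> 2 \<Longrightarrow> k \<le> 2 \<Longrightarrow> (s, t) \<in> \<Omega> \<Longrightarrow> \<bar>D j k s t\<bar> \<le> c j k"
    by (metis (no_types, lifting) case_prodD)
  define C where "C = (\<Sum>j\<le>2. \<Sum>k\<le>2. \<bar>c j k\<bar>)"
  have "\<bar>D j k s t\<bar> \<le> C" if "j \<le> 2" "k \<le> 2" "(s, t) \<in> \<Omega>" for j k s t
  proof -
    have "\<bar>D j k s t\<bar> \<le> \<bar>c j k\<bar>" using c[OF that] by linarith
    also have "\<dots> \<le> (\<Sum>k\<le>2. \<bar>c j k\<bar>)" using that by (intro member_le_sum) auto
    also have "\<dots> \<le> C" unfolding C_def using that by (intro member_le_sum) (auto intro: sum_nonneg)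
    finally show ?thesis .
  qed
  moreover have "((\<lambda>u. D j k u t) has_real_derivative D (Suc j) k s t) (at s within {u. (u, t) \<in> \<Omega>})"
    if "j < 2" "k \<le> 2" "(s, t) \<in> \<Omega>" for j k s t
    using D1[rule_format, of j k "(s, t)"] that by simp
  moreover have "((\<lambda>u. D j k s u) has_real_derivative D j (Suc k) s t) (at t within {u. (s, u) \<in> \<Omega>})"
    if "j \<le> 2" "k < 2" "(s, t) \<in> \<Omega>" for j k s t
    using D2[rule_format, of j k "(s, t)"] that by simp
  ultimately have "smooth_piece D \<Omega> C"
    using assms(2,3) by (intro smooth_piece.intro) blast+
  moreover have "\<And>s t. (s, t) \<in> \<Omega> \<Longrightarrow> D 0 0 s t = g s t" using D0 by auto
  ultimately show ?thesis by (rule that)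
qed

text \<open>
  For \<open>m + v \<le> t\<close> or \<open>t \<le> m - v\<close> the second difference is of order \<open>v\<^sup>2\<close>, as for a smooth kernel. Near the
  diagonal it is only of order \<open>v\<close>, but there the kernel is piecewise linear up to second order, which
  makes the second difference even in \<open>t - m\<close> up to second order.
\<close>
definition second_diff :: "(real \<Rightarrow> real \<Rightarrow> real) \<Rightarrow> real \<Rightarrow> real \<Rightarrow> real \<Rightarrow> real"
  where "second_diff \<kappa> m v t = \<kappa> (m + v) t + \<kappa> (m - v) t - 2 * \<kappa> m t"

text \<open>Everything later used about the kernel, free of derivatives and with a single constant.
  Boundedness and the Lipschitz estimates hold across the diagonal. The second-order estimates keep
  to one side of it, except \<open>second_diff_almost_even\<close>, which controls the kink.\<close>

locale green_kernel =
  fixes \<kappa> :: "real \<Rightarrow> real \<Rightarrow> real" and C :: real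
  assumes bounded: "s \<in> {0..1} \<Longrightarrow> t \<in> {0..1} \<Longrightarrow> \<bar>\<kappa> s t\<bar> \<le> C"
    and lipschitz_fst: "s \<in> {0..1} \<Longrightarrow> s' \<in> {0..1} \<Longrightarrow> t \<in> {0..1} \<Longrightarrow> \<bar>\<kappa> s t - \<kappa> s' t\<bar> \<le> C * \<bar>s - s'\<bar>"
    and lipschitz_snd: "s \<in> {0..1} \<Longrightarrow> t \<in> {0..1} \<Longrightarrow> t' \<in> {0..1} \<Longrightarrow> \<bar>\<kappa> s t - \<kappa> s t'\<bar> \<le> C * \<bar>t - t'\<bar>"
    and mixed_difference: "{s, s', t, t'} \<subseteq> {0..1} \<Longrightarrow> max t t' \<le> min s s' \<or> max s s' \<le> min t t' \<Longrightarrow>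
      \<bar>\<kappa> s t - \<kappa> s' t - \<kappa> s t' + \<kappa> s' t'\<bar> \<le> C * \<bar>s - s'\<bar> * \<bar>t - t'\<bar>"
    and second_diff_off_diagonal: "0 \<le> v \<Longrightarrow> 0 \<le> m - v \<Longrightarrow> m + v \<le> 1 \<Longrightarrow> t \<in> {0..1} \<Longrightarrow> t \<le> m - v \<or> m + v \<le> t \<Longrightarrow>
      \<bar>second_diff \<kappa> m v t\<bar> \<le> C * v\<^sup>2"
    and second_diff_lipschitz: "0 \<le> v \<Longrightarrow> 0 \<le> m - v \<Longrightarrow> m + v \<le> 1 \<Longrightarrow> t \<in> {0..1} \<Longrightarrow> t' \<in> {0..1} \<Longrightarrow>
      max t t' \<le> m - v \<or> m + v \<le> min t t' \<Longrightarrow>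
      \<bar>second_diff \<kappa> m v t - second_diff \<kappa> m v t'\<bar> \<le> C * v\<^sup>2 * \<bar>t - t'\<bar>"
    and second_diff_almost_even: "0 \<le> m - d \<Longrightarrow> m + d \<le> 1 \<Longrightarrow> 0 \<le> v \<Longrightarrow> v \<le> d \<Longrightarrow> \<bar>w\<bar> \<le> d \<Longrightarrow>
      \<bar>second_diff \<kappa> m v (m + w) - second_diff \<kappa> m v (m - w)\<bar> \<le> C * d\<^sup>2"
    and linear_interpolation: "0 \<le> a \<Longrightarrow> a < b \<Longrightarrow> b \<le> 1 \<Longrightarrow> s \<in> {a..b} \<Longrightarrow> t \<in> {0..1} \<Longrightarrow> t \<le> a \<or> b \<le> t \<Longrightarrow>
      \<bar>\<kappa> s t - ((b - s) * \<kappa> a t + (s - a) * \<kappa> b t) / (b - a)\<bar> \<le> C * (b - a)\<^sup>2"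

lemma green_kernel_exists:
  assumes "green_type \<alpha> \<kappa>"
  obtains C where "green_kernel \<kappa> C"
proof -
  obtain \<kappa>1 \<kappa>2 where
    e1: "\<forall>(s, t)\<in>Omega1. \<kappa> s t = \<kappa>1 s t" and e2: "\<forall>(s, t)\<in>Omega2. \<kappa> s t = \<kappa>2 s t"
    and p: "partials_on ({0..2} \<times> {0..2}) Omega1 \<kappa>1" "partials_on ({0..2} \<times> {0..2}) Omega2 \<kappa>2"
    using assms unfolding green_type_def by auto
  have "convex {s. (s, t) \<in> Omega1}" "convex {s. (t, s) \<in> Omega1}"
    "convex {s. (s, t) \<in> Omega2}" "convex {s. (t, s) \<in> Omega2}" for t
  proof -
    have "{s. (s, t) \<in> Omega1} = (if 0 \<le> t then {t..1} else {})"
      "{s. (t, s) \<in> Omega1} = (if t \<le> 1 then {0..t} else {})"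
      "{s. (s, t) \<in> Omega2} = (if t \<le> 1 then {0..t} else {})"
      "{s. (t, s) \<in> Omega2} = (if 0 \<le> t then {t..1} else {})"
      by (auto simp: Omega1_def Omega2_def)
    then show "convex {s. (s, t) \<in> Omega1}" "convex {s. (t, s) \<in> Omega1}"
      "convex {s. (s, t) \<in> Omega2}" "convex {s. (t, s) \<in> Omega2}" by auto
  qed
  note cvx = this
  obtain D C1 where D: "smooth_piece D Omega1 C1" "\<And>s t. (s, t) \<in> Omega1 \<Longrightarrow> D 0 0 s t = \<kappa>1 s t"
    using smooth_piece_exists[OF p(1)] cvx by metis
  obtain E C2 where E: "smooth_piece E Omega2 C2" "\<And>s t. (s, t) \<in> Omega2 \<Longrightarrow> E 0 0 s t = \<kappa>2 s t"
    using smooth_piece_exists[OF p(2)] cvx by metis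
  define C where "C = max C1 C2"
  interpret D: smooth_piece D Omega1 C
    using smooth_piece_mono[OF D(1)] unfolding C_def by simp
  interpret E: smooth_piece E Omega2 C
    using smooth_piece_mono[OF E(1)] unfolding C_def by simp
  have k1: "\<kappa> s t = D 0 0 s t" if "0 \<le> t" "t \<le> s" "s \<le> 1" for s t
    using that e1 D(2)[of s t] by (auto simp: Omega1_def)
  have k2: "\<kappa> s t = E 0 0 s t" if "0 \<le> s" "s \<le> t" "t \<le> 1" for s t
    using that e2 E(2)[of s t] by (auto simp: Omega2_def)
  have O1: "(s, t) \<in> Omega1 \<longleftrightarrow> 0 \<le> t \<and> t \<le> s \<and> s \<le> 1" for s t by (simp add: Omega1_def)
  have O2: "(s, t) \<in> Omega2 \<longleftrightarrow> 0 \<le> s \<and> s \<le> t \<and> t \<le> 1" for s t by (simp add: Omega2_def)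
  have C0: "0 \<le> C" using D.bound[of 0 0 0 0] by (simp add: O1)
  have lf: "\<bar>\<kappa> s t - \<kappa> s' t\<bar> \<le> C * (s' - s)" if "0 \<le> s" "s \<le> s'" "s' \<le> 1" "t \<in> {0..1}" for s s' t
  proof -
    consider "t \<le> s" | "s' \<le> t" | "s \<le> t" "t \<le> s'" by linarith
    then show ?thesis
    proof cases
      case 1 then show ?thesis using that D.lipschitz_fst[of 0 0 s t s'] by (simp add: k1 O1)
    next
      case 2 then show ?thesis using that E.lipschitz_fst[of 0 0 s t s'] by (simp add: k2 O2)
    next
      \<comment> \<open>The path from \<open>s\<close> to \<open>s'\<close> crosses the diagonal at
        \<open>(t, t)\<close>, where both pieces agree with the kernel, so the two one-sided
        estimates add up.\<close>
      case 3
      have "\<bar>\<kappa> t t - \<kappa> s' t\<bar> \<le> C * (s' - t)"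
        using that 3 D.lipschitz_fst[of 0 0 t t s'] by (simp add: k1 O1)
      moreover have "\<bar>\<kappa> s t - \<kappa> t t\<bar> \<le> C * (t - s)"
        using that 3 E.lipschitz_fst[of 0 0 s t t] by (simp add: k2 O2)
      ultimately show ?thesis by (simp add: algebra_simps)
    qed
  qed
  have ls: "\<bar>\<kappa> s t - \<kappa> s t'\<bar> \<le> C * (t' - t)" if "0 \<le> t" "t \<le> t'" "t' \<le> 1" "s \<in> {0..1}" for s t t'
  proof -
    consider "t' \<le> s" | "s \<le> t" | "t \<le> s" "s \<le> t'" by linarith
    then show ?thesis
    proof cases
      case 1 then show ?thesis using that D.lipschitz_snd[of 0 0 s t t'] by (simp add: k1 O1)
    next
      case 2 then show ?thesis using that E.lipschitz_snd[of 0 0 s t t'] by (simp add: k2 O2)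
    next
      case 3
      have "\<bar>\<kappa> s s - \<kappa> s t\<bar> \<le> C * (s - t)"
        using that 3 D.lipschitz_snd[of 0 0 s s t] by (simp add: k1 O1)
      moreover have "\<bar>\<kappa> s s - \<kappa> s t'\<bar> \<le> C * (t' - s)"
        using that 3 E.lipschitz_snd[of 0 0 s s t'] by (simp add: k2 O2)
      ultimately show ?thesis by (simp add: algebra_simps)
    qed
  qed
  \<comment> \<open>The constant comes from \<open>second_diff_almost_even\<close>: two second
    differences involve eight kernel values counted with multiplicity, each with a remainder of at
    most \<open>3 * C * d\<^sup>2\<close>. The other estimates need at most
    \<open>2 * C\<close>.\<close>
  have "green_kernel \<kappa> (24 * C)"
  proof
    fix s s' t t' :: real
    have C1: "C * x \<le> 24 * C * x" "2 * C * x \<le> 24 * C * x" if "0 \<le> x" for x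
      using C0 that mult_nonneg_nonneg[of C x] by auto
    show "\<bar>\<kappa> s t\<bar> \<le> 24 * C" if "s \<in> {0..1}" "t \<in> {0..1}"
      using that D.bound[of 0 0 s t] E.bound[of 0 0 s t] C0 by (cases "t \<le> s") (auto simp: k1 k2 O1 O2)
    show "\<bar>\<kappa> s t - \<kappa> s' t\<bar> \<le> 24 * C * \<bar>s - s'\<bar>" if "s \<in> {0..1}" "s' \<in> {0..1}" "t \<in> {0..1}"
      using lf[of s s' t] lf[of s' s t] that C1(1)[of "\<bar>s - s'\<bar>"] by (cases "s \<le> s'") (auto simp: abs_minus_commute)
    show "\<bar>\<kappa> s t - \<kappa> s t'\<bar> \<le> 24 * C * \<bar>t - t'\<bar>" if "s \<in> {0..1}" "t \<in> {0..1}" "t' \<in> {0..1}"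
      using ls[of t t' s] ls[of t' t s] that C1(1)[of "\<bar>t - t'\<bar>"] by (cases "t \<le> t'") (auto simp: abs_minus_commute)
    show "\<bar>\<kappa> s t - \<kappa> s' t - \<kappa> s t' + \<kappa> s' t'\<bar> \<le> 24 * C * \<bar>s - s'\<bar> * \<bar>t - t'\<bar>"
      if "{s, s', t, t'} \<subseteq> {0..1}" "max t t' \<le> min s s' \<or> max s s' \<le> min t t'"
      using that D.mixed_difference[of s t s' t'] E.mixed_difference[of s t s' t'] C1(1)[of "\<bar>s - s'\<bar> * \<bar>t - t'\<bar>"]
      by (auto simp: k1 k2 O1 O2 mult.assoc)
    fix m v d w a b :: real
    show "\<bar>second_diff \<kappa> m v t\<bar> \<le> 24 * C * v\<^sup>2"
      if "0 \<le> v" "0 \<le> m - v" "m + v \<le> 1" "t \<in> {0..1}" "t \<le> m - v \<or> m + v \<le> t"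
      using that D.second_difference_fst[of m t v] E.second_difference_fst[of m t v] C1(2)[of "v\<^sup>2"]
      unfolding second_diff_def by (auto simp: k1 k2 O1 O2)
    show "\<bar>second_diff \<kappa> m v t - second_diff \<kappa> m v t'\<bar> \<le> 24 * C * v\<^sup>2 * \<bar>t - t'\<bar>"
      if "0 \<le> v" "0 \<le> m - v" "m + v \<le> 1" "t \<in> {0..1}" "t' \<in> {0..1}" "max t t' \<le> m - v \<or> m + v \<le> min t t'"
      using that D.second_difference_fst_lipschitz[of m t v t'] E.second_difference_fst_lipschitz[of m t v t']
        C1(2)[of "v\<^sup>2 * \<bar>t - t'\<bar>"]
      unfolding second_diff_def by (auto simp: k1 k2 O1 O2 mult.assoc)
    show "\<bar>\<kappa> s t - ((b - s) * \<kappa> a t + (s - a) * \<kappa> b t) / (b - a)\<bar> \<le> 24 * C * (b - a)\<^sup>2"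
      if "0 \<le> a" "a < b" "b \<le> 1" "s \<in> {a..b}" "t \<in> {0..1}" "t \<le> a \<or> b \<le> t"
      using that D.linear_interpolation_fst[of a t b s] E.linear_interpolation_fst[of a t b s] C1(2)[of "(b - a)\<^sup>2"]
      by (auto simp: k1 k2 O1 O2)
    show "\<bar>second_diff \<kappa> m v (m + w) - second_diff \<kappa> m v (m - w)\<bar> \<le> 24 * C * d\<^sup>2"
      if md: "0 \<le> m - d" "m + d \<le> 1" and v: "0 \<le> v" "v \<le> d" and w: "\<bar>w\<bar> \<le> d"
    proof -
      have r1: "\<bar>\<kappa> (m + x) (m + y) - \<kappa> m m - D 1 0 m m * x - D 0 1 m m * y\<bar> \<le> 3 * C * d\<^sup>2"
        if "y \<le> x" "\<bar>x\<bar> \<le> d" "\<bar>y\<bar> \<le> d" for x y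
      proof -
        have "0 \<le> m" "m \<le> 1" "0 \<le> m + y" "m + x \<le> 1" "0 \<le> x \<or> y \<le> 0" using that md by linarith+
        then show ?thesis using D.taylor_corner[of m x y d] that by (simp add: k1 O1)
      qed
      have r2: "\<bar>\<kappa> (m + x) (m + y) - \<kappa> m m - E 1 0 m m * x - E 0 1 m m * y\<bar> \<le> 3 * C * d\<^sup>2"
        if "x \<le> y" "\<bar>x\<bar> \<le> d" "\<bar>y\<bar> \<le> d" for x y
      proof -
        have "0 \<le> m" "m \<le> 1" "0 \<le> m + x" "m + y \<le> 1" "x \<le> 0 \<or> 0 \<le> y" using that md by linarith+
        then show ?thesis using E.taylor_corner[of m x y d] that by (simp add: k2 O2)
      qed
      have *: "\<bar>second_diff \<kappa> m v (m + w) - second_diff \<kappa> m v (m - w)\<bar> \<le> 24 * C * d\<^sup>2"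
        if w: "0 \<le> w" "w \<le> d" for w
      proof -
        have sd: "second_diff \<kappa> m v (m + w) = \<kappa> (m + v) (m + w) + \<kappa> (m + - v) (m + w) - 2 * \<kappa> (m + 0) (m + w)"
          "second_diff \<kappa> m v (m - w) = \<kappa> (m + v) (m + - w) + \<kappa> (m + - v) (m + - w) - 2 * \<kappa> (m + 0) (m + - w)"
          by (simp_all add: second_diff_def)
        have ab: "\<bar>v\<bar> \<le> d" "\<bar>-v\<bar> \<le> d" "\<bar>w\<bar> \<le> d" "\<bar>-w\<bar> \<le> d" "\<bar>0\<bar> \<le> d" "- v \<le> w" "- w \<le> v" "- w \<le> 0"
          using v w by auto
        \<comment> \<open>The linear parts of the two second differences agree, so only remainders
          are left. With all derivatives at \<open>(m, m)\<close>, for \<open>w \<le> v\<close> both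
          linear parts are \<open>(D 1 0 - E 1 0) * v + (D 0 1 - E 0 1) * w\<close>; for
          \<open>v < w\<close> each second difference uses a single piece and its linear part
          vanishes.\<close>
        show ?thesis
      proof (cases "w \<le> v")
        case True
        then have "- v \<le> - w" by simp
        note R = r1[OF True ab(1,3)] r2[OF ab(6,2,3)] r2[OF w(1) ab(5,3)] r1[OF ab(7,1,4)]
          r2[OF this ab(2,4)] r1[OF ab(8,5,4)]
        show ?thesis
          using R[unfolded abs_le_iff] unfolding sd abs_le_iff by (simp only: mult_minus_right) linarith
      next
        case False
        then have "v \<le> w" "- w \<le> - v" by simp_all
        note R = r2[OF this(1) ab(1,3)] r2[OF ab(6,2,3)] r2[OF w(1) ab(5,3)] r1[OF ab(7,1,4)]
          r1[OF this(2) ab(2,4)] r1[OF ab(8,5,4)]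
        show ?thesis
          using R[unfolded abs_le_iff] unfolding sd abs_le_iff by (simp only: mult_minus_right) linarith
      qed
      qed
      show ?thesis
        using *[of w] *[of "-w"] w by (cases "0 \<le> w") (auto simp: abs_minus_commute)
    qed
  qed
  then show ?thesis by (rule that)
qed

section \<open>The integral operator on essentially bounded functions\<close>

lemma ess_bounded_rep_linf: "ess_bounded (rep_linf X)"
  using Quotient3_rep_reflp[OF Quotient3_linf, of X] by (simp add: linf_rel_def)

lemma abs_rep_linf: "abs_linf (rep_linf X) = X"
  by (rule Quotient3_abs_rep[OF Quotient3_linf])

lemma abs_linf_eqI:
  assumes "ess_bounded x" "ess_bounded y" "AE t in unit_leb. x t = y t"
  shows "abs_linf x = abs_linf y"
  using assms by (intro Quotient3_rel_abs[OF Quotient3_linf]) (simp add: linf_rel_def)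

lemma rep_abs_linf_AE:
  assumes "ess_bounded x"
  shows "AE t in unit_leb. rep_linf (abs_linf x) t = x t"
  using rep_abs_rsp_left[OF Quotient3_linf, of x x] assms by (simp add: linf_rel_def)

lemma abs_linf_add: "ess_bounded x \<Longrightarrow> ess_bounded y \<Longrightarrow> abs_linf x + abs_linf y = abs_linf (\<lambda>t. x t + y t)"
  by (simp add: plus_linf.abs_eq linf_rel_def)

lemma abs_linf_scaleR: "ess_bounded x \<Longrightarrow> c *\<^sub>R abs_linf x = abs_linf (\<lambda>t. c * x t)"
  by (simp add: scaleR_linf.abs_eq linf_rel_def)

lemma ess_bounded_diff: "ess_bounded x \<Longrightarrow> ess_bounded y \<Longrightarrow> ess_bounded (\<lambda>t. x t - y t)"
  using ess_bounded_add[of x "\<lambda>t. -1 * y t"] ess_bounded_scale[of y "-1"] by simp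

lemma abs_linf_diff: "ess_bounded x \<Longrightarrow> ess_bounded y \<Longrightarrow> abs_linf x - abs_linf y = abs_linf (\<lambda>t. x t - y t)"
  using abs_linf_add[of x "\<lambda>t. -1 * y t"] abs_linf_scaleR[of y "-1"] ess_bounded_scale[of y "-1"]
  by (simp add: diff_conv_add_uminus del: add_uminus_conv_diff)

lemma rep_linf_diff_AE: "AE t in unit_leb. rep_linf (X - Y) t = rep_linf X t - rep_linf Y t"
  using rep_abs_linf_AE[OF ess_bounded_diff[OF ess_bounded_rep_linf ess_bounded_rep_linf], of X Y]
  by (simp add: abs_linf_diff[OF ess_bounded_rep_linf ess_bounded_rep_linf, symmetric] abs_rep_linf)

lemma rep_linf_add_AE: "AE t in unit_leb. rep_linf (X + Y) t = rep_linf X t + rep_linf Y t"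
  using rep_abs_linf_AE[OF ess_bounded_add[OF ess_bounded_rep_linf ess_bounded_rep_linf], of X Y]
  by (simp add: abs_linf_add[OF ess_bounded_rep_linf ess_bounded_rep_linf, symmetric] abs_rep_linf)

lemma rep_linf_scaleR_AE: "AE t in unit_leb. rep_linf (c *\<^sub>R X) t = c * rep_linf X t"
  using rep_abs_linf_AE[OF ess_bounded_scale[OF ess_bounded_rep_linf], of c X]
  by (simp add: abs_linf_scaleR[OF ess_bounded_rep_linf, symmetric] abs_rep_linf)

lemma norm_linf_eq_ess_norm: "norm X = ess_norm (rep_linf X)"
  using norm_linf.abs_eq[of "rep_linf X"] ess_bounded_rep_linf[of X] by (simp add: abs_rep_linf linf_rel_def)

lemma rep_linf_le_norm: "AE t in unit_leb. \<bar>rep_linf X t\<bar> \<le> norm X"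
  unfolding norm_linf_eq_ess_norm by (rule AE_le_ess_norm[OF ess_bounded_rep_linf])

lemma norm_linf_le: "(AE t in unit_leb. \<bar>rep_linf X t\<bar> \<le> c) \<Longrightarrow> norm X \<le> c"
  unfolding norm_linf_eq_ess_norm by (rule ess_norm_le[OF ess_bounded_rep_linf])

lemma norm_abs_linf_le:
  assumes "ess_bounded x" "AE t in unit_leb. \<bar>x t\<bar> \<le> c"
  shows "norm (abs_linf x) \<le> c"
  using ess_norm_le[OF assms] assms(1) by (simp add: norm_linf.abs_eq linf_rel_def)

lemma AE_unit_lebI: "(\<And>t. t \<in> {0..1} \<Longrightarrow> Q t) \<Longrightarrow> AE t in unit_leb. Q t"
  by (rule AE_I2) simp

lemma finite_measure_unit_leb: "finite_measure unit_leb"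
  by (rule finite_measure_lebesgue_on) simp

text \<open>A non-integrable \<open>f\<close> has Bochner integral 0, and \<open>g\<close> is
  nonnegative almost everywhere. This spares measurability side conditions on
  \<open>f\<close>.\<close>

lemma integral_AE_bound:
  fixes f g :: "'a \<Rightarrow> real"
  assumes "integrable M g" "AE t in M. \<bar>f t\<bar> \<le> g t"
  shows "\<bar>integral\<^sup>L M f\<bar> \<le> integral\<^sup>L M g"
proof (cases "integrable M f")
  case True
  have "\<bar>integral\<^sup>L M f\<bar> \<le> (\<integral>t. \<bar>f t\<bar> \<partial>M)"
    using integral_norm_bound[of M f] by simp
  also have "\<dots> \<le> integral\<^sup>L M g"
    using True assms by (intro integral_mono_AE) auto
  finally show ?thesis .
next
  case False
  have "0 \<le> integral\<^sup>L M g"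
    using assms(2) by (intro integral_nonneg_AE) auto
  with False show ?thesis by (simp add: not_integrable_integral_eq)
qed

lemma abs_mult_le:
  fixes a b :: real
  assumes "\<bar>a\<bar> \<le> A" "\<bar>b\<bar> \<le> B"
  shows "\<bar>a * b\<bar> \<le> A * B"
  unfolding abs_mult using assms by (intro mult_mono) linarith+

lemma integrable_mult_ess_bounded:
  assumes F: "continuous_on {0..1} F" and x: "ess_bounded x"
  shows "integrable unit_leb (\<lambda>t. F t * x t)"
proof -
  interpret finite_measure unit_leb by (rule finite_measure_unit_leb)
  have "ess_bounded F" by (rule ess_bounded_continuous[OF F])
  then obtain A where A: "AE t in unit_leb. \<bar>F t\<bar> \<le> A" and mF: "F \<in> borel_measurable unit_leb"
    unfolding ess_bounded_def by auto
  obtain B where B: "AE t in unit_leb. \<bar>x t\<bar> \<le> B" and mx: "x \<in> borel_measurable unit_leb"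
    using x unfolding ess_bounded_def by auto
  show ?thesis
  proof (rule integrable_const_bound[where B = "A * B"])
    show "AE t in unit_leb. norm (F t * x t) \<le> A * B"
      using A B by eventually_elim (simp add: abs_mult_le)
  qed (use mF mx in measurable)
qed

lemma fredholm_diff_eq:
  assumes "continuous_on {0..1} (\<kappa> s)" "continuous_on {0..1} (\<kappa> s')" "ess_bounded x"
  shows "fredholm \<kappa> x s - fredholm \<kappa> x s' = (\<integral>t. (\<kappa> s t - \<kappa> s' t) * x t \<partial>unit_leb)"
  unfolding fredholm_def left_diff_distrib
  using assms by (intro Bochner_Integration.integral_diff[symmetric] integrable_mult_ess_bounded)

lemma integral_unit_leb_bound:
  fixes F x :: "real \<Rightarrow> real"
  assumes x: "AE t in unit_leb. \<bar>x t\<bar> \<le> B" and F: "\<And>t. t \<in> {0..1} \<Longrightarrow> \<bar>F t\<bar> \<le> A"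
  shows "\<bar>\<integral>t. F t * x t \<partial>unit_leb\<bar> \<le> A * B"
proof -
  interpret finite_measure unit_leb by (rule finite_measure_unit_leb)
  have "AE t in unit_leb. \<bar>F t\<bar> \<le> A" using F by (rule AE_unit_lebI)
  with x have "AE t in unit_leb. \<bar>F t * x t\<bar> \<le> A * B"
    by eventually_elim (simp add: abs_mult_le)
  then have "\<bar>\<integral>t. F t * x t \<partial>unit_leb\<bar> \<le> (\<integral>t. A * B \<partial>unit_leb)"
    by (intro integral_AE_bound) auto
  then show ?thesis using emeasure_unit_leb by (simp add: measure_def)
qed

context green_kernel
begin

section \<open>Boundedness, smoothing and linearity of the integral operator\<close>

lemma C_nonneg: "0 \<le> C"
  using bounded[of 0 0] by simp

lemma continuous_snd: "s \<in> {0..1} \<Longrightarrow> continuous_on {0..1} (\<kappa> s)"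
  using lipschitz_snd[of s] C_nonneg
  by (intro lipschitz_on_continuous_on[where L = C] lipschitz_onI) (auto simp: dist_real_def)

lemma fredholm_bound:
  assumes "s \<in> {0..1}"
  shows "\<bar>fredholm \<kappa> (rep_linf X) s\<bar> \<le> C * norm X"
  unfolding fredholm_def by (rule integral_unit_leb_bound[OF rep_linf_le_norm]) (use bounded assms in auto)

lemma fredholm_lipschitz:
  assumes "s \<in> {0..1}" "s' \<in> {0..1}"
  shows "\<bar>fredholm \<kappa> (rep_linf X) s - fredholm \<kappa> (rep_linf X) s'\<bar> \<le> C * \<bar>s - s'\<bar> * norm X"
  unfolding fredholm_diff_eq[OF continuous_snd[OF assms(1)] continuous_snd[OF assms(2)] ess_bounded_rep_linf]
  by (rule integral_unit_leb_bound[OF rep_linf_le_norm]) (use lipschitz_fst assms in auto)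

lemma continuous_fredholm: "continuous_on {0..1} (fredholm \<kappa> (rep_linf X))"
  using fredholm_lipschitz[of _ _ X] C_nonneg
  by (intro lipschitz_on_continuous_on[where L = "C * norm X"] lipschitz_onI)
    (auto simp: dist_real_def mult_ac)

lemmas ess_bounded_fredholm = ess_bounded_continuous[OF continuous_fredholm]

text \<open>Allows the representative chosen by \<open>rep_linf\<close> to be exchanged for an
  explicit function; the values agree at every \<open>s\<close>, not merely almost
  everywhere.\<close>

lemma fredholm_cong_AE:
  assumes "AE t in unit_leb. x t = y t" "ess_bounded x" "ess_bounded y" "s \<in> {0..1}"
  shows "fredholm \<kappa> x s = fredholm \<kappa> y s"
  unfolding fredholm_def
  using integrable_mult_ess_bounded[OF continuous_snd[OF assms(4)]] assms(1-3)
  by (intro integral_cong_AE) auto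

lemma norm_fredholm_linf_le: "norm (fredholm_linf \<kappa> X) \<le> C * norm X"
  unfolding fredholm_linf_def
  by (intro norm_abs_linf_le[OF ess_bounded_fredholm] AE_unit_lebI fredholm_bound)

lemma linear_fredholm_linf: "linear (fredholm_linf \<kappa>)"
proof (rule linearI)
  note int = integrable_mult_ess_bounded[OF continuous_snd ess_bounded_rep_linf]
  fix X Y
  have "fredholm \<kappa> (rep_linf (X + Y)) s = fredholm \<kappa> (rep_linf X) s + fredholm \<kappa> (rep_linf Y) s"
    if s: "s \<in> {0..1}" for s
    unfolding fredholm_cong_AE[OF rep_linf_add_AE ess_bounded_rep_linf
      ess_bounded_add[OF ess_bounded_rep_linf ess_bounded_rep_linf] s]
    using int[OF s] by (simp add: fredholm_def algebra_simps)
  then show "fredholm_linf \<kappa> (X + Y) = fredholm_linf \<kappa> X + fredholm_linf \<kappa> Y"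
    unfolding fredholm_linf_def abs_linf_add[OF ess_bounded_fredholm ess_bounded_fredholm]
    by (intro abs_linf_eqI ess_bounded_fredholm ess_bounded_add AE_unit_lebI)
  fix c :: real
  have "fredholm \<kappa> (rep_linf (c *\<^sub>R X)) s = c * fredholm \<kappa> (rep_linf X) s"
    if s: "s \<in> {0..1}" for s
    unfolding fredholm_cong_AE[OF rep_linf_scaleR_AE ess_bounded_rep_linf
      ess_bounded_scale[OF ess_bounded_rep_linf] s]
    by (simp add: fredholm_def mult.left_commute)
  then show "fredholm_linf \<kappa> (c *\<^sub>R X) = c *\<^sub>R fredholm_linf \<kappa> X"
    unfolding fredholm_linf_def abs_linf_scaleR[OF ess_bounded_fredholm]
    by (intro abs_linf_eqI ess_bounded_fredholm ess_bounded_scale AE_unit_lebI)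
qed

text \<open>
  Compactness replaces completeness here: along a sequence violating the estimate the images under the
  integral operator converge by Arzela-Ascoli, and the limit would be an eigenfunction.
\<close>
lemma fredholm_bounded_below:
  assumes "\<not> eigenvalue_of (fredholm_linf \<kappa>) 1"
  obtains c where "0 < c" "\<And>X. norm X \<le> c * norm (X - fredholm_linf \<kappa> X)"
proof -
  let ?K = "fredholm_linf \<kappa>"
  interpret K: linear ?K by (rule linear_fredholm_linf)
  have "\<exists>c>0. \<forall>X. norm X \<le> c * norm (X - ?K X)"
  proof (rule ccontr)
    assume "\<not> (\<exists>c>0. \<forall>X. norm X \<le> c * norm (X - ?K X))"
    then have "\<exists>X. norm X > real (Suc n) * norm (X - ?K X)" for n
      by (metis not_le of_nat_0_less_iff zero_less_Suc)
    then obtain X where X: "\<And>n. norm (X n) > real (Suc n) * norm (X n - ?K (X n))" by metis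
    define Y where "Y n = X n /\<^sub>R norm (X n)" for n
    have X0: "norm (X n) > 0" for n
      using X[of n] by (smt (verit) mult_nonneg_nonneg norm_ge_zero of_nat_0_le_iff)
    have Y1: "norm (Y n) = 1" for n
      using X0[of n] by (simp add: Y_def)
    have YK: "norm (Y n - ?K (Y n)) \<le> inverse (real (Suc n))" for n
    proof -
      have "Y n - ?K (Y n) = (X n - ?K (X n)) /\<^sub>R norm (X n)"
        by (simp add: Y_def K.scale scaleR_diff_right)
      then have "norm (Y n - ?K (Y n)) = norm (X n - ?K (X n)) / norm (X n)"
        by (simp add: divide_inverse_commute)
      also have "\<dots> \<le> inverse (real (Suc n))"
        using X[of n] X0[of n] by (simp add: field_simps del: of_nat_Suc)
      finally show ?thesis .
    qed
    define G where "G n = fredholm \<kappa> (rep_linf (Y n))" for n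
    \<comment> \<open>Equicontinuity: all \<open>G n\<close> are Lipschitz with constant
      \<open>C\<close>, since the \<open>Y n\<close> are unit vectors. The witness divides by
      \<open>C + 1\<close> because \<open>C\<close> may be 0.\<close>
    have "\<exists>d>0. \<forall>n t. t \<in> {0..1} \<and> norm (s - t) < d \<longrightarrow> norm (G n s - G n t) < e"
      if "s \<in> {0..1}" "0 < e" for s e
    proof (intro exI[of _ "e / (C + 1)"] conjI allI impI)
      fix n t assume t: "t \<in> {0..1} \<and> norm (s - t) < e / (C + 1)"
      have "norm (G n s - G n t) \<le> C * \<bar>s - t\<bar>"
        using fredholm_lipschitz[of s t "Y n"] that t by (simp add: G_def Y1)
      also have "\<dots> \<le> (C + 1) * \<bar>s - t\<bar>" by (intro mult_right_mono) auto
      also have "\<dots> < e" using t C_nonneg by (simp add: field_simps)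
      finally show "norm (G n s - G n t) < e" .
    qed (use that C_nonneg in auto)
    moreover have "norm (G n s) \<le> C" if "s \<in> {0..1}" for n s
      using fredholm_bound[OF that, of "Y n"] by (simp add: G_def Y1)
    ultimately obtain g k where g: "continuous_on {0..1} g" "strict_mono (k :: nat \<Rightarrow> nat)"
      and conv: "\<And>e. 0 < e \<Longrightarrow> \<exists>N. \<forall>n x. n \<ge> N \<and> x \<in> {0..1} \<longrightarrow> norm (G (k n) x - g x) < e"
      using Arzela_Ascoli[of "{0..1::real}" G C] by (metis compact_Icc)
    define Z where "Z = abs_linf g"
    note bg = ess_bounded_continuous[OF g(1)]
    have "(\<lambda>n. ?K (Y (k n))) \<longlonglongrightarrow> Z"
    proof (rule LIMSEQ_I)
      fix e :: real assume "0 < e"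
      then obtain N where N: "\<And>n x. n \<ge> N \<Longrightarrow> x \<in> {0..1} \<Longrightarrow> \<bar>G (k n) x - g x\<bar> < e / 2"
        using conv[of "e / 2"] by (auto simp: real_norm_def)
      have "norm (?K (Y (k n)) - Z) < e" if "n \<ge> N" for n
      proof -
        have "norm (?K (Y (k n)) - Z) \<le> e / 2"
          unfolding fredholm_linf_def Z_def abs_linf_diff[OF ess_bounded_fredholm bg]
          using N[OF that] unfolding G_def
          by (intro norm_abs_linf_le ess_bounded_diff ess_bounded_fredholm bg AE_unit_lebI less_imp_le)
        then show ?thesis using \<open>0 < e\<close> by simp
      qed
      then show "\<exists>N. \<forall>n\<ge>N. norm (?K (Y (k n)) - Z) < e" by blast
    qed
    moreover have "(\<lambda>n. Y (k n) - ?K (Y (k n))) \<longlonglongrightarrow> 0"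
    proof -
      have "(\<lambda>n. Y n - ?K (Y n)) \<longlonglongrightarrow> 0"
        by (rule Lim_null_comparison[OF _ LIMSEQ_inverse_real_of_nat]) (use YK in auto)
      then show ?thesis
        using LIMSEQ_subseq_LIMSEQ[OF _ g(2)] by (auto simp: o_def)
    qed
    \<comment> \<open>The unit vectors themselves converge, as sums of two convergent sequences. So
      \<open>Z\<close> has norm 1, and continuity of the operator makes it a fixed point.\<close>
    ultimately have Y: "(\<lambda>n. Y (k n)) \<longlonglongrightarrow> Z"
      using tendsto_add by fastforce
    have "bounded_linear ?K"
      using linear_fredholm_linf norm_fredholm_linf_le
      by (metis bounded_linear_intro K.add K.scale mult.commute)
    from bounded_linear.tendsto[OF this Y] \<open>(\<lambda>n. ?K (Y (k n))) \<longlonglongrightarrow> Z\<close>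
    have "?K Z = Z" by (rule LIMSEQ_unique)
    moreover have "Z \<noteq> 0"
      using tendsto_norm[OF Y] by (auto simp: Y1 LIMSEQ_const_iff)
    ultimately show False
      using assms unfolding eigenvalue_of_def by (metis scaleR_one)
  qed
  then show ?thesis using that by blast
qed

end

section \<open>Piecewise polynomials and finite rank\<close>

text \<open>The injective map \<open>T = I - F\<close> sends \<open>span B\<close> into itself,
  hence onto itself by counting dimensions. Since \<open>F y\<close> lies in that span,
  \<open>F y = T v\<close> for some \<open>v\<close>, and then \<open>T (y + v) = y\<close>.\<close>

lemma injective_finite_rank_perturbation_surj:
  fixes F :: "'a::real_vector \<Rightarrow> 'a"
  assumes "linear F" "finite B" "range F \<subseteq> span B" and inj: "\<And>x. x - F x = 0 \<Longrightarrow> x = 0"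
  shows "\<exists>x. x - F x = y"
proof -
  interpret F: linear F by fact
  define T where "T x = x - F x" for x
  have "linear T" unfolding T_def by (intro linear_compose_sub linear_ident assms(1))
  note T = this
  obtain B' where B': "independent B'" "span B' = span B"
    using basis_exists[of "span B"] by (metis span_minimal subspace_span subset_antisym)
  have fin: "finite B'"
    using independent_span_bound[OF assms(2) B'(1)] B'(2) span_superset[of B'] by simp
  have injT: "inj T"
    unfolding linear_inj_iff_eq_0[OF T] using inj by (simp add: T_def)
  have ind: "independent (T ` B')"
    by (rule linear_independent_injective_image[OF T B'(1) inj_on_subset[OF injT subset_UNIV]])
  have sub: "T ` B' \<subseteq> span B'"
  proof
    fix z assume "z \<in> T ` B'"
    then obtain b where b: "b \<in> B'" "z = b - F b" by (auto simp: T_def)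
    have "F b \<in> span B'" using assms(3) B'(2) by auto
    with b show "z \<in> span B'" by (simp add: span_base span_diff)
  qed
  \<comment> \<open>Otherwise adjoining \<open>F y\<close> to the image of the basis would give an
    independent subset of \<open>span B'\<close> with more elements than \<open>B'\<close>.\<close>
  have "F y \<in> span (T ` B')"
  proof (rule ccontr)
    assume n: "F y \<notin> span (T ` B')"
    then have nin: "F y \<notin> T ` B'" by (auto intro: span_base)
    with n ind have "independent (insert (F y) (T ` B'))"
      by (simp add: independent_insert)
    moreover have "insert (F y) (T ` B') \<subseteq> span B'"
      using sub assms(3) B'(2) by auto
    ultimately have "card (insert (F y) (T ` B')) \<le> card B'"
      using independent_span_bound[OF fin] by blast
    moreover have "card (T ` B') = card B'"
      by (rule card_image[OF inj_on_subset[OF injT subset_UNIV]])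
    ultimately show False using nin fin by simp
  qed
  then obtain v where "F y = T v"
    unfolding linear_span_image[OF T] by auto
  then have "(y + v) - F (y + v) = y" by (simp add: T_def F.add)
  then show ?thesis ..
qed

text \<open>Adjacent closed cells share their end points; discarding this null set makes the cell of
  a point unique.\<close>

lemma AE_off_grid: "AE t in unit_leb. t \<notin> range (\<lambda>j :: nat. real j / real n)"
proof -
  have "range (\<lambda>j :: nat. real j / real n) \<in> null_sets lborel"
    by (intro countable_imp_null_set_lborel) auto
  then have "AE t in lebesgue. t \<notin> range (\<lambda>j :: nat. real j / real n)"
    by (intro AE_not_in null_sets_completionI)
  then show ?thesis
    by (subst AE_restrict_space_iff) (auto elim: eventually_mono)
qed

text \<open>A concrete representative of a piecewise polynomial. The ceiling assigns a grid point to
  the cell on its left, and \<open>t = 0\<close> to the index 0, which belongs to no cell; such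
  points form a null set.\<close>

definition pw_poly :: "nat \<Rightarrow> (nat \<Rightarrow> real poly) \<Rightarrow> real \<Rightarrow> real"
  where "pw_poly n p t = poly (p (nat \<lceil>real n * t\<rceil>)) t"

lemma pw_poly_cell:
  assumes "1 \<le> n" "t \<in> cell n j" "1 \<le> j" "t \<notin> range (\<lambda>j :: nat. real j / real n)"
  shows "pw_poly n p t = poly (p j) t"
proof -
  have "real j - 1 \<le> real n * t" "real n * t \<le> real j"
    using assms(1,2) by (auto simp: cell_def field_simps)
  moreover have "real n * t \<noteq> real j - 1"
    using assms(1,3,4) by (metis (no_types, lifting) nonzero_mult_div_cancel_left not_one_le_zero of_nat_1 of_nat_diff of_nat_eq_0_iff rangeI)
  ultimately have "\<lceil>real n * t\<rceil> = int j" by (intro ceiling_unique) auto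
  then show ?thesis by (simp add: pw_poly_def)
qed

lemma obtain_cell:
  assumes "1 \<le> n" "t \<in> {0..1}"
  obtains j where "j \<in> {1..n}" "t \<in> cell n j"
proof (cases "t = 0")
  case True
  with assms(1) show ?thesis by (intro that[of 1]) (auto simp: cell_def)
next
  case False
  define j where "j = nat \<lceil>real n * t\<rceil>"
  have t: "0 < real n * t" "real n * t \<le> real n" using assms False by auto
  then have j: "int j = \<lceil>real n * t\<rceil>" by (simp add: j_def)
  with t have "j \<in> {1..n}" by (simp add: j_def) linarith
  moreover have "real j - 1 \<le> real n * t" "real n * t \<le> real j"
    using j ceiling_correct[of "real n * t"] by (metis less_imp_le of_int_of_nat_eq)+
  then have "t \<in> cell n j" using assms(1) by (simp add: cell_def field_simps)
  ultimately show ?thesis by (rule that)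
qed

text \<open>Glues cellwise statements together. The relation \<open>R\<close> is arbitrary so that
  the lemma serves for equality with a representative as well as for error bounds.\<close>

lemma pw_poly_AE_eqI:
  assumes "1 \<le> n" "\<And>j. j \<in> {1..n} \<Longrightarrow> AE t in unit_leb. t \<in> cell n j \<longrightarrow> R t (poly (p j) t)"
  shows "AE t in unit_leb. R t (pw_poly n p t)"
proof -
  have "AE t in unit_leb. \<forall>j\<in>{1..n}. t \<in> cell n j \<longrightarrow> R t (poly (p j) t)"
    using assms(2) by (intro AE_finite_allI) auto
  moreover have "AE t in unit_leb. t \<in> {0..1}" by (rule AE_unit_lebI)
  ultimately show ?thesis
    using AE_off_grid[of n]
  proof eventually_elim
    case (elim t)
    obtain j where "j \<in> {1..n}" "t \<in> cell n j" using obtain_cell[OF assms(1) elim(2)] .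
    with elim pw_poly_cell[OF assms(1), of t j p] show ?case by auto
  qed
qed

lemma ess_bounded_pw_poly: "ess_bounded (pw_poly n p)"
proof -
  have "pw_poly n p \<in> borel_measurable borel"
    unfolding pw_poly_def
    by (rule measurable_compose_countable) (auto intro!: borel_measurable_continuous_onI continuous_intros)
  then have m: "pw_poly n p \<in> borel_measurable unit_leb"
    by (intro measurable_restrict_space1 measurable_completion) simp
  have "\<exists>c. \<forall>t\<in>{0..1}. \<bar>poly (p j) t\<bar> \<le> c" for j
  proof -
    have "continuous_on {0..1} (poly (p j))" by (intro continuous_at_imp_continuous_on) simp
    then have "bounded (poly (p j) ` {0..1})" by (intro compact_imp_bounded compact_continuous_image) auto
    then show ?thesis by (simp add: bounded_iff)
  qed
  then obtain c where c: "\<And>j t. t \<in> {0..1} \<Longrightarrow> \<bar>poly (p j) t\<bar> \<le> c j" by metis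
  \<comment> \<open>The sum includes the index 0, which the ceiling yields at
    \<open>t = 0\<close>.\<close>
  have "\<bar>pw_poly n p t\<bar> \<le> (\<Sum>j\<le>n. \<bar>c j\<bar>)" if t: "t \<in> {0..1}" for t
  proof -
    let ?j = "nat \<lceil>real n * t\<rceil>"
    have "real n * t \<le> real n" using t by (simp add: mult_left_le)
    then have j: "?j \<in> {..n}" by (simp add: nat_le_iff ceiling_le_iff)
    have "\<bar>pw_poly n p t\<bar> \<le> \<bar>c ?j\<bar>" using c[OF t, of ?j] by (simp add: pw_poly_def)
    also have "\<dots> \<le> (\<Sum>j\<le>n. \<bar>c j\<bar>)" using j by (intro member_le_sum) auto
    finally show ?thesis .
  qed
  with m show ?thesis unfolding ess_bounded_def by (blast intro: AE_unit_lebI)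
qed

lemma abs_linf_pw_poly_in_space:
  assumes "1 \<le> n" "\<And>j. j \<in> {1..n} \<Longrightarrow> degree (p j) \<le> 2 * r"
  shows "abs_linf (pw_poly n p) \<in> pw_poly_space r n"
  unfolding pw_poly_space_def
proof (intro CollectI ballI)
  fix j assume j: "j \<in> {1..n}"
  have "AE t in unit_leb. t \<in> cell n j \<longrightarrow> rep_linf (abs_linf (pw_poly n p)) t = poly (p j) t"
    using rep_abs_linf_AE[OF ess_bounded_pw_poly, of n p] AE_off_grid[of n]
    by eventually_elim (use pw_poly_cell[OF assms(1), of _ j p] j in auto)
  with assms(2)[OF j] show "\<exists>q. degree q \<le> 2 * r \<and>
      (AE t in unit_leb. t \<in> cell n j \<longrightarrow> rep_linf (abs_linf (pw_poly n p)) t = poly q t)" by blast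
qed

lemma abs_linf_pw_poly_sum:
  assumes "finite A"
  shows "abs_linf (pw_poly n (\<lambda>j. \<Sum>a\<in>A. smult (c a) (q a j))) = (\<Sum>a\<in>A. c a *\<^sub>R abs_linf (pw_poly n (q a)))"
  using assms
proof (induction A)
  case empty
  show ?case by (simp add: pw_poly_def zero_linf.abs_eq)
next
  case (insert a A)
  have "pw_poly n (\<lambda>j. \<Sum>a\<in>insert a A. smult (c a) (q a j)) =
      (\<lambda>t. c a * pw_poly n (q a) t + pw_poly n (\<lambda>j. \<Sum>a\<in>A. smult (c a) (q a j)) t)"
    using insert by (auto simp: pw_poly_def)
  then show ?case
    using insert
    by (simp add: abs_linf_add[symmetric] abs_linf_scaleR ess_bounded_pw_poly ess_bounded_scale)
qed

text \<open>The spanning set consists of the monomials of degree at most \<open>2 * r\<close>, each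
  cut off to a single cell; the coefficients are those of the cell polynomials.\<close>

lemma pw_poly_space_finite_dim:
  assumes "1 \<le> n"
  obtains B where "finite B" "pw_poly_space r n \<subseteq> span B"
proof -
  define q where "q a i = (if i = fst a then monom (1 :: real) (snd a) else 0)" for a :: "nat \<times> nat" and i
  define B where "B = (\<lambda>a. abs_linf (pw_poly n (q a))) ` ({1..n} \<times> {..2 * r})"
  have "X \<in> span B" if X: "X \<in> pw_poly_space r n" for X
  proof -
    obtain p where p: "\<And>j. j \<in> {1..n} \<Longrightarrow> degree (p j) \<le> 2 * r"
      "\<And>j. j \<in> {1..n} \<Longrightarrow> AE t in unit_leb. t \<in> cell n j \<longrightarrow> rep_linf X t = poly (p j) t"
      using X unfolding pw_poly_space_def mem_Collect_eq by metis
    let ?A = "{1..n} \<times> {..2 * r}"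
    let ?p = "\<lambda>i. \<Sum>a\<in>?A. smult (coeff (p (fst a)) (snd a)) (q a i)"
    have peq: "?p j = p j" if j: "j \<in> {1..n}" for j
    proof -
      have "?p j = (\<Sum>i\<in>{1..n}. \<Sum>k\<le>2 * r. smult (coeff (p i) k) (q (i, k) j))"
        by (simp add: sum.cartesian_product case_prod_unfold)
      also have "\<dots> = (\<Sum>i\<in>{1..n}. if i = j then (\<Sum>k\<le>2 * r. monom (coeff (p i) k) k) else 0)"
        by (intro sum.cong) (auto simp: q_def smult_monom)
      also have "\<dots> = (\<Sum>k\<le>2 * r. monom (coeff (p j) k) k)" using j by simp
      also have "\<dots> = p j" using p(1)[OF j] by (rule poly_as_sum_of_monoms')
      finally show ?thesis .
    qed
    have "AE t in unit_leb. rep_linf X t = pw_poly n ?p t"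
      by (rule pw_poly_AE_eqI[OF assms]) (simp only: peq p(2))
    then have "X = abs_linf (pw_poly n ?p)"
      using abs_linf_eqI[OF ess_bounded_rep_linf ess_bounded_pw_poly] by (simp only: abs_rep_linf)
    also have "\<dots> = (\<Sum>a\<in>?A. coeff (p (fst a)) (snd a) *\<^sub>R abs_linf (pw_poly n (q a)))"
      by (rule abs_linf_pw_poly_sum) simp
    also have "\<dots> \<in> span B"
      by (intro span_sum span_scale span_base) (auto simp: B_def)
    finally show ?thesis .
  qed
  moreover have "finite B" by (simp add: B_def)
  ultimately show ?thesis using that by blast
qed

text \<open>
  Since \<open>Q\<close> fixes \<open>X\<^sub>n\<close> and is bounded, its error on \<open>x\<close> is at most \<open>1 + M\<close> times the distance of \<open>x\<close>
  to \<open>X\<^sub>n\<close>.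
\<close>
lemma projection_error:
  fixes Q :: "linf \<Rightarrow>\<^sub>L linf"
  assumes n: "1 \<le> n" and Q: "\<And>X. X \<in> pw_poly_space r n \<Longrightarrow> Q X = X" "norm Q \<le> M"
    and x: "ess_bounded x" and p: "\<And>j. j \<in> {1..n} \<Longrightarrow> degree (p j) \<le> 2 * r"
    and close: "\<And>j t. j \<in> {1..n} \<Longrightarrow> t \<in> cell n j \<Longrightarrow> t \<in> {0..1} \<Longrightarrow> \<bar>x t - poly (p j) t\<bar> \<le> \<epsilon>"
  shows "norm (abs_linf x - Q (abs_linf x)) \<le> (1 + M) * \<epsilon>"
proof -
  let ?y = "abs_linf (pw_poly n p)"
  let ?d = "abs_linf x - ?y"
  have "Q ?y = ?y" by (intro Q abs_linf_pw_poly_in_space n p)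
  then have "abs_linf x - Q (abs_linf x) = ?d - Q ?d" by (simp add: blinfun.diff_right)
  moreover have "norm (?d - Q ?d) \<le> norm ?d + norm (Q ?d)" by (rule norm_triangle_ineq4)
  moreover have "norm (Q ?d) \<le> M * norm ?d"
    using norm_blinfun[of Q ?d] mult_right_mono[OF Q(2) norm_ge_zero[of ?d]] by linarith
  ultimately have "norm (abs_linf x - Q (abs_linf x)) \<le> (1 + M) * norm ?d"
    by (simp add: algebra_simps)
  also have "\<dots> \<le> (1 + M) * \<epsilon>"
  proof (intro mult_left_mono)
    have "AE t in unit_leb. \<bar>x t - pw_poly n p t\<bar> \<le> \<epsilon>"
      by (rule pw_poly_AE_eqI[OF n, where R = "\<lambda>t z. \<bar>x t - z\<bar> \<le> \<epsilon>"])
        (use close in \<open>auto intro: AE_unit_lebI\<close>)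
    then show "norm ?d \<le> \<epsilon>"
      unfolding abs_linf_diff[OF x ess_bounded_pw_poly]
      by (intro norm_abs_linf_le ess_bounded_diff x ess_bounded_pw_poly)
    show "0 \<le> 1 + M" using Q(2) norm_ge_zero[of Q] by linarith
  qed
  finally show ?thesis .
qed

section \<open>Linearity and finite rank of the modified operator\<close>

lemma mod_colloc_op_linear:
  fixes Q :: "linf \<Rightarrow>\<^sub>L linf"
  assumes "linear K"
  shows "linear (mod_colloc_op K Q)"
proof -
  interpret K: linear K by fact
  show ?thesis
    by (rule linearI)
      (simp_all add: mod_colloc_op_def K.add K.scale blinfun.add_right blinfun.scaleR_right algebra_simps)
qed

text \<open>Two of the three terms of the operator lie in the range of \<open>Q\<close> and the
  third in its image under \<open>K\<close>. The rank is therefore finite, and injectivity implies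
  surjectivity.\<close>

lemma mod_colloc_op_surj:
  fixes Q :: "linf \<Rightarrow>\<^sub>L linf"
  assumes "linear K" "1 \<le> n" "range Q \<subseteq> pw_poly_space r n"
    and "\<And>X. X - mod_colloc_op K Q X = 0 \<Longrightarrow> X = 0"
  shows "\<exists>X. X - mod_colloc_op K Q X = Y"
proof -
  interpret K: linear K by fact
  obtain B where B: "finite B" "pw_poly_space r n \<subseteq> span B"
    using pw_poly_space_finite_dim[OF assms(2)] .
  have "Q X \<in> span (B \<union> K ` B)" for X
    using assms(3) B(2) span_mono[of B "B \<union> K ` B"] by blast
  moreover have "K (Q X) \<in> span (B \<union> K ` B)" for X
  proof -
    have "K (Q X) \<in> span (K ` B)" unfolding linear_span_image[OF assms(1)] using assms(3) B(2) by blast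
    then show ?thesis using span_mono[of "K ` B" "B \<union> K ` B"] by blast
  qed
  ultimately have "range (mod_colloc_op K Q) \<subseteq> span (B \<union> K ` B)"
    by (auto simp: mod_colloc_op_def intro!: span_diff span_add)
  with B(1) assms(4) show ?thesis
    by (intro injective_finite_rank_perturbation_surj[OF mod_colloc_op_linear[OF assms(1)]]) auto
qed

section \<open>Projection errors\<close>

lemma cell_subset_unit:
  assumes "j \<in> {1..n}"
  shows "cell n j \<subseteq> {0..1}"
proof -
  have "0 \<le> (real j - 1) / real n" "real j / real n \<le> 1" using assms by auto
  then show ?thesis unfolding cell_def by fastforce
qed

text \<open>Taylor polynomials at the left ends of the cells, with \<open>B\<close> a bound of the
  derivative of order \<open>2 * r + 1\<close>. Since \<open>projection_error\<close> only measures
  the distance to the piecewise polynomials, no remainder formula for interpolation enters.\<close>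

lemma smooth_piecewise_taylor:
  assumes "Ck_on_unit (2 * r + 2) \<phi>"
  obtains B where "0 \<le> B" "\<And>n. 1 \<le> n \<Longrightarrow> \<exists>p. (\<forall>j\<in>{1..n}. degree (p j) \<le> 2 * r) \<and>
    (\<forall>j\<in>{1..n}. \<forall>t\<in>cell n j. \<bar>\<phi> t - poly (p j) t\<bar> \<le> B * (1 / real n) ^ (2 * r + 1))"
proof -
  obtain D where D: "\<forall>s\<in>{0..1}. D 0 s = \<phi> s"
    "\<forall>i<2 * r + 2. \<forall>s\<in>{0..1}. (D i has_real_derivative D (Suc i) s) (at s within {0..1})"
    "\<forall>i\<le>2 * r + 2. continuous_on {0..1} (D i)"
    using assms unfolding Ck_on_unit_def by blast
  have "continuous_on {0..1} (D (Suc (2 * r)))" using D(3) by simp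
  then have "bounded (D (Suc (2 * r)) ` {0..1})" by (intro compact_imp_bounded compact_continuous_image) auto
  then obtain b where b: "\<forall>s\<in>{0..1}. \<bar>D (Suc (2 * r)) s\<bar> \<le> b" by (auto simp: bounded_iff)
  then have b0: "0 \<le> b" by (metis abs_ge_zero order_trans atLeastAtMost_iff order_refl zero_le_one)
  have "\<exists>p. (\<forall>j\<in>{1..n}. degree (p j) \<le> 2 * r) \<and>
    (\<forall>j\<in>{1..n}. \<forall>t\<in>cell n j. \<bar>\<phi> t - poly (p j) t\<bar> \<le> b * (1 / real n) ^ (2 * r + 1))"
    if n: "1 \<le> n" for n
  proof -
    define w where "w j = (real j - 1) / real n" for j
    define p where "p j = (\<Sum>i\<le>2 * r. smult (D i (w j) / fact i) ([:- w j, 1:] ^ i))" for j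
    have "degree (p j) \<le> 2 * r" for j
      unfolding p_def
    proof (intro degree_sum_le)
      fix i assume "i \<in> {..2 * r}"
      then show "degree (smult (D i (w j) / fact i) ([:- w j, 1:] ^ i)) \<le> 2 * r"
        using degree_power_le[of "[:- w j, 1:]" i] by (intro order_trans[OF degree_smult_le]) auto
    qed auto
    moreover have "\<bar>\<phi> t - poly (p j) t\<bar> \<le> b * (1 / real n) ^ (2 * r + 1)"
      if j: "j \<in> {1..n}" and t: "t \<in> cell n j" for j t
    proof -
      have "w j \<in> cell n j" using n by (simp add: w_def cell_def divide_right_mono)
      then have w: "w j \<in> {0..1}" "t \<in> {0..1}" using cell_subset_unit[OF j] t by auto
      have "norm (D 0 t - (\<Sum>i\<le>2 * r. D i (w j) * (t - w j) ^ i / fact i))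
        \<le> b * norm (t - w j) ^ Suc (2 * r) / fact (2 * r)"
        by (rule field_Taylor[of "{0..1}"]) (use D b w in auto)
      also have "poly (p j) t = (\<Sum>i\<le>2 * r. D i (w j) * (t - w j) ^ i / fact i)"
        by (simp add: p_def poly_sum)
      then have "norm (D 0 t - (\<Sum>i\<le>2 * r. D i (w j) * (t - w j) ^ i / fact i)) = \<bar>\<phi> t - poly (p j) t\<bar>"
        using D(1) w by simp
      also have "b * norm (t - w j) ^ Suc (2 * r) / fact (2 * r) \<le> b * norm (t - w j) ^ Suc (2 * r)"
        using divide_left_mono[OF fact_ge_1, of "b * norm (t - w j) ^ Suc (2 * r)"] b0
        by (simp del: power_Suc fact_Suc)
      also have "norm (t - w j) \<le> 1 / real n"
        using t by (auto simp: w_def cell_def diff_divide_distrib)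
      then have "b * norm (t - w j) ^ Suc (2 * r) \<le> b * (1 / real n) ^ Suc (2 * r)"
        using b0 by (intro mult_left_mono power_mono) auto
      finally show ?thesis by simp
    qed
    ultimately show ?thesis by blast
  qed
  with b0 that show ?thesis by blast
qed

lemma Ck_on_unit_continuous: "Ck_on_unit k x \<Longrightarrow> continuous_on {0..1} x"
  unfolding Ck_on_unit_def by (metis (no_types, lifting) continuous_on_cong le0)

section \<open>Approximation of images under the integral operator\<close>

context green_kernel
begin

text \<open>Images under the operator are Lipschitz with constant \<open>C * norm X\<close>, so the
  value at the left end of each cell is a good enough approximant. Constants are admissible for
  every \<open>r\<close>, including 0; this is the smallness behind stability.\<close>

lemma piecewise_constant_error:
  fixes Q :: "linf \<Rightarrow>\<^sub>L linf"
  assumes n: "1 \<le> n" and Q: "\<And>Y. Y \<in> pw_poly_space r n \<Longrightarrow> Q Y = Y" "norm Q \<le> M"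
  shows "norm (fredholm_linf \<kappa> X - Q (fredholm_linf \<kappa> X)) \<le> (1 + M) * (C * (1 / real n) * norm X)"
  unfolding fredholm_linf_def
proof (rule projection_error[OF n Q ess_bounded_fredholm])
  let ?g = "fredholm \<kappa> (rep_linf X)"
  let ?p = "\<lambda>j. [:?g ((real j - 1) / real n):]"
  show "degree (?p j) \<le> 2 * r" for j by simp
  fix j t assume j: "j \<in> {1..n}" and t: "t \<in> cell n j"
  let ?a = "(real j - 1) / real n"
  have "?a \<in> cell n j" using n by (simp add: cell_def divide_right_mono)
  then have u: "?a \<in> {0..1}" "t \<in> {0..1}" using cell_subset_unit[OF j] t by auto
  have "\<bar>t - ?a\<bar> \<le> 1 / real n" using t by (auto simp: cell_def diff_divide_distrib)
  then have "C * \<bar>t - ?a\<bar> * norm X \<le> C * (1 / real n) * norm X"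
    using C_nonneg by (intro mult_right_mono mult_left_mono) auto
  then show "\<bar>?g t - poly (?p j) t\<bar> \<le> C * (1 / real n) * norm X"
    using fredholm_lipschitz[OF u(2,1), of X] by simp
qed

text \<open>Interpolating the kernel in \<open>s\<close> has error of order
  \<open>(b - a)\<^sup>2\<close> for \<open>t\<close> outside \<open>{a..b}\<close>. Inside, where
  the diagonal is met, the error is only of order \<open>b - a\<close>, but that interval has length
  \<open>b - a\<close>. The majorant \<open>G\<close> adds the two contributions.\<close>

lemma fredholm_linear_interpolation:
  assumes ab: "0 \<le> a" "a < b" "b \<le> 1" and s: "s \<in> {a..b}"
  shows "\<bar>fredholm \<kappa> (rep_linf X) s
      - ((b - s) * fredholm \<kappa> (rep_linf X) a + (s - a) * fredholm \<kappa> (rep_linf X) b) / (b - a)\<bar>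
    \<le> 2 * C * (b - a)\<^sup>2 * norm X"
proof -
  interpret finite_measure unit_leb by (rule finite_measure_unit_leb)
  define \<mu> where "\<mu> = (b - s) / (b - a)"
  define \<nu> where "\<nu> = (s - a) / (b - a)"
  have l: "0 \<le> \<mu>" "0 \<le> \<nu>" "\<mu> + \<nu> = 1"
    using ab s by (auto simp: \<mu>_def \<nu>_def add_divide_distrib[symmetric])
  have split: "((b - s) * u + (s - a) * v) / (b - a) = \<mu> * u + \<nu> * v" for u v
    by (simp add: \<mu>_def \<nu>_def add_divide_distrib)
  define F where "F t = \<kappa> s t - (\<mu> * \<kappa> a t + \<nu> * \<kappa> b t)" for t
  define G where "G t = C * (b - a)\<^sup>2 * norm X + C * (b - a) * norm X * indicator {a..b} t" for t :: real
  let ?g = "fredholm \<kappa> (rep_linf X)"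
  have ms: "{a..b} \<in> sets unit_leb"
    using ab by (subst sets_restrict_space_iff) auto
  note int = integrable_mult_ess_bounded[OF continuous_snd ess_bounded_rep_linf]
  have "?g s - (\<mu> * ?g a + \<nu> * ?g b) = (\<integral>t. F t * rep_linf X t \<partial>unit_leb)"
    using int[of s X] int[of a X] int[of b X] ab s
    by (simp add: F_def fredholm_def algebra_simps)
  moreover have "\<bar>\<integral>t. F t * rep_linf X t \<partial>unit_leb\<bar> \<le> integral\<^sup>L unit_leb G"
  proof (rule integral_AE_bound)
    show "integrable unit_leb G"
      unfolding G_def by (intro Bochner_Integration.integrable_add integrable_mult_right integrable_const
          integrable_real_indicator) (use ms in \<open>auto simp: emeasure_eq_measure\<close>)
    have F: "\<bar>F t\<bar> \<le> C * (b - a)\<^sup>2 + C * (b - a) * indicator {a..b} t" if t: "t \<in> {0..1}" for t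
    proof (cases "t \<in> {a..b}")
      case False
      then show ?thesis
        using linear_interpolation[OF ab s t] unfolding F_def split by auto
    next
      case True
      have "F t = \<mu> * (\<kappa> s t - \<kappa> a t) + \<nu> * (\<kappa> s t - \<kappa> b t)"
        using l(3) unfolding F_def by (simp add: algebra_simps flip: distrib_right distrib_left)
      then have "\<bar>F t\<bar> \<le> \<mu> * \<bar>\<kappa> s t - \<kappa> a t\<bar> + \<nu> * \<bar>\<kappa> s t - \<kappa> b t\<bar>"
        using l abs_triangle_ineq[of "\<mu> * (\<kappa> s t - \<kappa> a t)" "\<nu> * (\<kappa> s t - \<kappa> b t)"] by (simp add: abs_mult)
      also have "\<dots> \<le> \<mu> * (C * (b - a)) + \<nu> * (C * (b - a))"
      proof (intro add_mono mult_left_mono l)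
        have "C * \<bar>s - a\<bar> \<le> C * (b - a)" "C * \<bar>s - b\<bar> \<le> C * (b - a)"
          using s C_nonneg by (auto intro!: mult_left_mono)
        then show "\<bar>\<kappa> s t - \<kappa> a t\<bar> \<le> C * (b - a)" "\<bar>\<kappa> s t - \<kappa> b t\<bar> \<le> C * (b - a)"
          using lipschitz_fst[of s a t] lipschitz_fst[of s b t] ab s t by force+
      qed
      also have "\<dots> = C * (b - a)" using l(3) by (simp flip: distrib_right)
      finally show ?thesis using True mult_nonneg_nonneg[OF C_nonneg zero_le_power2[of "b - a"]] by simp
    qed
    have "AE t in unit_leb. \<bar>F t\<bar> \<le> C * (b - a)\<^sup>2 + C * (b - a) * indicator {a..b} t"
      by (rule AE_unit_lebI[OF F])
    then show "AE t in unit_leb. \<bar>F t * rep_linf X t\<bar> \<le> G t"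
      using rep_linf_le_norm[of X]
    proof eventually_elim
      case (elim t)
      from abs_mult_le[OF elim] show ?case by (simp add: G_def algebra_simps)
    qed
  qed
  moreover have "integral\<^sup>L unit_leb G = 2 * C * (b - a)\<^sup>2 * norm X"
  proof -
    have "measure unit_leb {a..b} = b - a"
      using ab by (subst measure_restrict_space) auto
    moreover have "measure unit_leb (space unit_leb) = 1"
      using emeasure_unit_leb by (simp add: measure_def)
    ultimately show ?thesis
      unfolding G_def using ab ms
      by (subst Bochner_Integration.integral_add)
        (auto simp: emeasure_eq_measure power2_eq_square)
  qed
  ultimately show ?thesis unfolding split by simp
qed

text \<open>The approximant interpolates affinely at both ends of each cell; its degree 1 is
  admissible exactly because \<open>1 \<le> r\<close>.\<close>

lemma piecewise_linear_error:
  fixes Q :: "linf \<Rightarrow>\<^sub>L linf"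
  assumes n: "1 \<le> n" and r: "1 \<le> r" and Q: "\<And>Y. Y \<in> pw_poly_space r n \<Longrightarrow> Q Y = Y" "norm Q \<le> M"
  shows "norm (fredholm_linf \<kappa> X - Q (fredholm_linf \<kappa> X)) \<le> (1 + M) * (2 * C * (1 / real n)\<^sup>2 * norm X)"
  unfolding fredholm_linf_def
proof (rule projection_error[OF n Q ess_bounded_fredholm])
  let ?g = "fredholm \<kappa> (rep_linf X)"
  define a where "a j = (real j - 1) / real n" for j
  define b where "b j = real j / real n" for j
  define p where "p j = [:(b j * ?g (a j) - a j * ?g (b j)) / (b j - a j), (?g (b j) - ?g (a j)) / (b j - a j):]" for j
  show "degree (p j) \<le> 2 * r" for j using r by (simp add: p_def)
  fix j s assume j: "j \<in> {1..n}" and s: "s \<in> cell n j"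
  have ba: "b j - a j = 1 / real n" by (simp add: a_def b_def diff_divide_distrib)
  have ab: "0 \<le> a j" "a j < b j" "b j \<le> 1" "s \<in> {a j..b j}"
    using j s n by (auto simp: a_def b_def cell_def divide_strict_right_mono)
  have "poly (p j) s = ((b j - s) * ?g (a j) + (s - a j) * ?g (b j)) / (b j - a j)"
    by (simp add: p_def add_divide_distrib[symmetric] algebra_simps)
  then show "\<bar>?g s - poly (p j) s\<bar> \<le> 2 * C * (1 / real n)\<^sup>2 * norm X"
    using fredholm_linear_interpolation[OF ab, of X] ba by simp
qed

end

section \<open>Midpoint collocation\<close>

text \<open>Passage from the Lebesgue measure to the gauge integral: \<open>integral_spike\<close>
  expects an explicit negligible set.\<close>

lemma AE_unit_leb_negligible:
  assumes "AE t in unit_leb. Q t"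
  obtains N where "negligible N" "\<And>t. t \<in> {0..1} - N \<Longrightarrow> Q t"
proof -
  have "AE t in lebesgue. t \<in> {0..1} \<longrightarrow> Q t"
    using assms by (subst (asm) AE_restrict_space_iff) auto
  then obtain N where "N \<in> null_sets lebesgue" "{t \<in> space lebesgue. \<not> (t \<in> {0..1} \<longrightarrow> Q t)} \<subseteq> N"
    unfolding eventually_ae_filter by blast
  then show ?thesis
    using that[of N] by (auto simp: negligible_iff_null_sets)
qed

lemma integral_unit_cells:
  fixes f :: "real \<Rightarrow> real"
  assumes n: "1 \<le> n" and f: "f integrable_on {0..1}"
  shows "integral {0..1} f = (\<Sum>j\<in>{1..n}. integral (cell n j) f)"
proof -
  have "integral {0..real k / real n} f = (\<Sum>j\<in>{1..k}. integral (cell n j) f)" if "k \<le> n" for k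
    using that
  proof (induction k)
    case (Suc k)
    have "f integrable_on {0..real (Suc k) / real n}"
      using f by (rule integrable_on_subinterval) (use Suc in auto)
    then have "integral {0..real (Suc k) / real n} f
      = integral {0..real k / real n} f + integral {real k / real n..real (Suc k) / real n} f"
      by (intro Henstock_Kurzweil_Integration.integral_combine[symmetric]) (auto simp: divide_right_mono)
    with Suc show ?case by (simp add: cell_def)
  qed simp
  from this[of n] n show ?thesis by simp
qed

definition cell_mid :: "nat \<Rightarrow> nat \<Rightarrow> real"
  where "cell_mid n j = ((real j - 1) / real n + real j / real n) / 2"

lemma cell_eq_mid: "cell n j = {cell_mid n j - 1 / (2 * real n)..cell_mid n j + 1 / (2 * real n)}"
  by (simp add: cell_def cell_mid_def add_divide_distrib diff_divide_distrib)

lemma midpoint_interpolant_AE: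
  assumes "is_interpolant 0 n x Y" "j \<in> {1..n}"
  shows "AE t in unit_leb. t \<in> cell n j \<longrightarrow> rep_linf Y t = x (cell_mid n j)"
proof -
  obtain p :: "real poly" where p: "degree p \<le> 0" "poly p (cell_mid n j) = x (cell_mid n j)"
    "AE t in unit_leb. t \<in> cell n j \<longrightarrow> rep_linf Y t = poly p t"
    using assms unfolding is_interpolant_def colloc_pt_def cell_mid_def by fastforce
  obtain a where "p = [:a:]" using p(1) degree_eq_zeroE by blast
  with p(2,3) show ?thesis by simp
qed

text \<open>The integral of \<open>F\<close> against \<open>x\<close> minus its piecewise constant
  midpoint interpolant. Splitting it into cells gives access to the symmetry about each
  midpoint.\<close>

definition midpoint_defect :: "nat \<Rightarrow> (real \<Rightarrow> real) \<Rightarrow> (real \<Rightarrow> real) \<Rightarrow> real"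
  where "midpoint_defect n F x = (\<Sum>j\<in>{1..n}. integral (cell n j) (\<lambda>t. F t * (x t - x (cell_mid n j))))"

lemma integral_interpolation_error:
  assumes n: "1 \<le> n" and x: "continuous_on {0..1} x" and Y: "is_interpolant 0 n x Y"
    and F: "continuous_on {0..1} F"
  shows "(\<integral>t. F t * rep_linf (abs_linf x - Y) t \<partial>unit_leb) = midpoint_defect n F x"
proof -
  let ?z = "rep_linf (abs_linf x - Y)"
  have int: "integrable unit_leb (\<lambda>t. F t * ?z t)"
    by (rule integrable_mult_ess_bounded[OF F ess_bounded_rep_linf])
  then have "(\<integral>t. F t * ?z t \<partial>unit_leb) = integral {0..1} (\<lambda>t. F t * ?z t)"
    by (rule lebesgue_integral_eq_integral) simp
  also have "\<dots> = (\<Sum>j\<in>{1..n}. integral (cell n j) (\<lambda>t. F t * ?z t))"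
    using int by (intro integral_unit_cells n integrable_on_lebesgue_on) auto
  also have "\<dots> = midpoint_defect n F x"
    unfolding midpoint_defect_def
  proof (rule sum.cong[OF refl])
    fix j assume j: "j \<in> {1..n}"
    have "AE t in unit_leb. t \<in> cell n j \<longrightarrow> ?z t = x t - x (cell_mid n j)"
      using midpoint_interpolant_AE[OF Y j] rep_linf_diff_AE[of "abs_linf x" Y]
        rep_abs_linf_AE[OF ess_bounded_continuous[OF x]]
      by eventually_elim auto
    then obtain N where N: "negligible N"
      "\<And>t. t \<in> {0..1} - N \<Longrightarrow> t \<in> cell n j \<longrightarrow> ?z t = x t - x (cell_mid n j)"
      by (rule AE_unit_leb_negligible) blast
    show "integral (cell n j) (\<lambda>t. F t * ?z t) = integral (cell n j) (\<lambda>t. F t * (x t - x (cell_mid n j)))"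
      using N(2) cell_subset_unit[OF j] by (intro integral_spike[OF N(1)]) auto
  qed
  finally show ?thesis .
qed

text \<open>Pairing \<open>m + w\<close> with \<open>m - w\<close> turns the integrand into
  \<open>F (m + w) * (\<psi> (m + w) + \<psi> (m - w) - 2 * \<psi> m) + (F (m - w) - F (m + w)) * (\<psi> (m - w) - \<psi> m)\<close>.\<close>
lemma symmetric_cell_bound:
  fixes F \<psi> :: "real \<Rightarrow> real"
  assumes d: "0 \<le> d" and cont: "continuous_on {m - d..m + d} F" "continuous_on {m - d..m + d} \<psi>"
    and A: "\<And>w. w \<in> {0..d} \<Longrightarrow> \<bar>F (m + w)\<bar> \<le> A"
    and B: "\<And>w. w \<in> {0..d} \<Longrightarrow> \<bar>F (m + w) - F (m - w)\<bar> \<le> B"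
    and E: "\<And>w. w \<in> {0..d} \<Longrightarrow> \<bar>\<psi> (m - w) - \<psi> m\<bar> \<le> E"
    and S: "\<And>w. w \<in> {0..d} \<Longrightarrow> \<bar>\<psi> (m + w) + \<psi> (m - w) - 2 * \<psi> m\<bar> \<le> S"
  shows "\<bar>integral {m - d..m + d} (\<lambda>u. F u * (\<psi> u - \<psi> m))\<bar> \<le> d * (A * S + B * E)"
proof -
  define G where "G u = F u * (\<psi> u - \<psi> m)" for u
  have G: "continuous_on {m - d..m + d} G"
    unfolding G_def by (intro continuous_intros cont)
  have Gp: "continuous_on {0..d} (\<lambda>w. G (m + w))"
    by (rule continuous_on_compose2[OF G]) (auto intro!: continuous_intros)
  have Gm: "continuous_on {0..d} (\<lambda>w. G (m - w))"
    by (rule continuous_on_compose2[OF G]) (auto intro!: continuous_intros)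
  have Gm': "continuous_on {-d..0} (\<lambda>w. G (m + w))"
    by (rule continuous_on_compose2[OF G]) (auto intro!: continuous_intros)
  have "integral {m - d..m + d} G = integral {m - d..m} G + integral {m..m + d} G"
    using d G by (intro Henstock_Kurzweil_Integration.integral_combine[symmetric] integrable_continuous_interval) auto
  also have "integral {m..m + d} G = integral {0..d} (\<lambda>w. G (m + w))"
    using integral_shift[of 0 m d G] G d by (simp add: o_def add.commute continuous_on_subset)
  also have "integral {m - d..m} G = integral {-d..0} (\<lambda>w. G (m + w))"
    using integral_shift[of "-d" m 0 G] G d by (simp add: o_def add.commute continuous_on_subset)
  also have "\<dots> = integral {0..d} (\<lambda>w. G (m - w))"
    using Henstock_Kurzweil_Integration.integral_reflect_real[of d 0 "\<lambda>w. G (m - w)"] by simp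
  also have "integral {0..d} (\<lambda>w. G (m - w)) + integral {0..d} (\<lambda>w. G (m + w))
      = integral {0..d} (\<lambda>w. G (m - w) + G (m + w))"
    using Gp Gm by (intro Henstock_Kurzweil_Integration.integral_add[symmetric] integrable_continuous_interval)
  also have "norm \<dots> \<le> (A * S + B * E) * (d - 0)"
  proof (rule integral_bound)
    fix w assume w: "w \<in> {0..d}"
    have "G (m - w) + G (m + w) =
        F (m + w) * (\<psi> (m + w) + \<psi> (m - w) - 2 * \<psi> m) + (F (m - w) - F (m + w)) * (\<psi> (m - w) - \<psi> m)"
      by (simp add: G_def algebra_simps)
    also have "norm \<dots> \<le> A * S + B * E"
      unfolding real_norm_def
      using add_mono[OF abs_mult_le[OF A[OF w] S[OF w]] abs_mult_le[OF B[OF w, unfolded abs_minus_commute[of "F (m + w)"]] E[OF w]]]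
      by (rule order_trans[OF abs_triangle_ineq])
    finally show "norm (G (m - w) + G (m + w)) \<le> A * S + B * E" .
  qed (use d Gp Gm in \<open>auto intro!: continuous_intros\<close>)
  finally show ?thesis by (simp add: G_def mult.commute)
qed

text \<open>One exceptional cell \<open>i\<close>, later the one met by the diagonal, may have worse
  bounds \<open>A'\<close> and \<open>B'\<close>: it enters only once and so keeps the factor
  \<open>1 / real n\<close>, which the sum over the other cells uses up. \<open>A\<close> and
  \<open>B\<close> are assumed nonnegative because for \<open>n = 1\<close> there is no far cell
  that would imply it.\<close>

lemma midpoint_defect_bound:
  assumes n: "1 \<le> n" and F: "continuous_on {0..1} F" and x: "continuous_on {0..1} x"
    and i: "i \<in> {1..n}"
    and far: "\<And>j w. j \<in> {1..n} \<Longrightarrow> j \<noteq> i \<Longrightarrow> w \<in> {0..1 / (2 * real n)} \<Longrightarrow>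
      \<bar>F (cell_mid n j + w)\<bar> \<le> A \<and> \<bar>F (cell_mid n j + w) - F (cell_mid n j - w)\<bar> \<le> B"
    and near: "\<And>w. w \<in> {0..1 / (2 * real n)} \<Longrightarrow>
      \<bar>F (cell_mid n i + w)\<bar> \<le> A' \<and> \<bar>F (cell_mid n i + w) - F (cell_mid n i - w)\<bar> \<le> B'"
    and ES: "\<And>j w. j \<in> {1..n} \<Longrightarrow> w \<in> {0..1 / (2 * real n)} \<Longrightarrow>
      \<bar>x (cell_mid n j - w) - x (cell_mid n j)\<bar> \<le> E \<and>
      \<bar>x (cell_mid n j + w) + x (cell_mid n j - w) - 2 * x (cell_mid n j)\<bar> \<le> S"
    and nn: "0 \<le> A" "0 \<le> B"
  shows "\<bar>midpoint_defect n F x\<bar> \<le> (A * S + B * E) + (1 / real n) * (A' * S + B' * E)"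
proof -
  let ?d = "1 / (2 * real n)"
  have d: "0 \<le> ?d" "?d \<le> 1 / real n" using n by (auto simp: field_simps)
  have "0 \<le> S" "0 \<le> E" using ES[OF i, of 0] d by auto
  moreover have "0 \<le> A'" "0 \<le> B'" using near[of 0] d by auto
  ultimately have nn': "0 \<le> A * S + B * E" "0 \<le> A' * S + B' * E" using nn by auto
  have cell: "continuous_on {cell_mid n j - ?d..cell_mid n j + ?d} F"
    "continuous_on {cell_mid n j - ?d..cell_mid n j + ?d} x" if "j \<in> {1..n}" for j
    using cell_subset_unit[OF that] F x by (auto simp: cell_eq_mid intro: continuous_on_subset)
  have nonneg: "0 \<le> 1 / real n * (A * S + B * E)" using nn'(1) by simp
  \<comment> \<open>The far bound is charged to cell \<open>i\<close> as well, so that the sum over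
    all cells is immediate.\<close>
  define b where "b j = 1 / real n * (A * S + B * E) + (if j = i then 1 / real n * (A' * S + B' * E) else 0)" for j
  have "\<bar>integral (cell n j) (\<lambda>t. F t * (x t - x (cell_mid n j)))\<bar> \<le> b j" if j: "j \<in> {1..n}" for j
  proof (cases "j = i")
    case True
    have "\<bar>integral (cell n j) (\<lambda>t. F t * (x t - x (cell_mid n j)))\<bar> \<le> ?d * (A' * S + B' * E)"
      unfolding cell_eq_mid using near ES[OF j] True
      by (intro symmetric_cell_bound d cell j) auto
    also have "\<dots> \<le> b j" unfolding b_def if_P[OF True] using mult_right_mono[OF d(2) nn'(2)] nonneg by linarith
    finally show ?thesis .
  next
    case False
    have "\<bar>integral (cell n j) (\<lambda>t. F t * (x t - x (cell_mid n j)))\<bar> \<le> ?d * (A * S + B * E)"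
      unfolding cell_eq_mid using far[OF j False] ES[OF j]
      by (intro symmetric_cell_bound d cell j) auto
    also have "\<dots> \<le> b j" unfolding b_def if_not_P[OF False] using mult_right_mono[OF d(2) nn'(1)] by linarith
    finally show ?thesis .
  qed
  then have "\<bar>midpoint_defect n F x\<bar> \<le> (\<Sum>j\<in>{1..n}. b j)"
    unfolding midpoint_defect_def by (intro order_trans[OF sum_abs] sum_mono)
  also have "\<dots> = (A * S + B * E) + 1 / real n * (A' * S + B' * E)"
    unfolding b_def sum.distrib using i n by simp
  finally show ?thesis .
qed

lemma cells_ordered:
  assumes "s \<in> cell n i" "t \<in> cell n j" "i < j"
  shows "s \<le> t"
proof -
  have "s \<le> real i / real n" "(real j - 1) / real n \<le> t" using assms by (auto simp: cell_def)
  moreover have "real i / real n \<le> (real j - 1) / real n" using assms(3) by (intro divide_right_mono) auto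
  ultimately show ?thesis by linarith
qed

lemma cell_mid_shift:
  assumes "w \<in> {0..1 / (2 * real n)}"
  shows "cell_mid n j + w \<in> cell n j" "cell_mid n j - w \<in> cell n j" "cell_mid n j \<in> cell n j"
  using assms by (auto simp: cell_eq_mid)

section \<open>Gain of order at the cell midpoints\<close>

context green_kernel
begin

text \<open>Both estimates are instances of \<open>midpoint_defect_bound\<close> with
  \<open>E = L * h\<close> and \<open>S = L * h\<^sup>2\<close>, where
  \<open>h = 1 / real n\<close>: first for the difference of the kernel at \<open>s\<close> and at
  the midpoint, then for its second difference. The integrand of the second is one order smaller in
  far cells, and in cell \<open>i\<close> its almost evenness takes over.\<close>

lemma midpoint_defect_near:
  assumes n: "1 \<le> n" and x: "continuous_on {0..1} x" "is_interpolant 0 n x Y" and L: "0 \<le> L"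
    and ES: "\<And>j w. j \<in> {1..n} \<Longrightarrow> w \<in> {0..1 / (2 * real n)} \<Longrightarrow>
      \<bar>x (cell_mid n j - w) - x (cell_mid n j)\<bar> \<le> L * (1 / real n) \<and>
      \<bar>x (cell_mid n j + w) + x (cell_mid n j - w) - 2 * x (cell_mid n j)\<bar> \<le> L * (1 / real n)\<^sup>2"
    and i: "i \<in> {1..n}"
  shows "\<And>s. s \<in> cell n i \<Longrightarrow> \<bar>fredholm \<kappa> (rep_linf (abs_linf x - Y)) s
      - fredholm \<kappa> (rep_linf (abs_linf x - Y)) (cell_mid n i)\<bar> \<le> 5 * C * L * (1 / real n) ^ 3"
    and "\<And>v. v \<in> {0..1 / (2 * real n)} \<Longrightarrow> \<bar>fredholm \<kappa> (rep_linf (abs_linf x - Y)) (cell_mid n i + v)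
      + fredholm \<kappa> (rep_linf (abs_linf x - Y)) (cell_mid n i - v)
      - 2 * fredholm \<kappa> (rep_linf (abs_linf x - Y)) (cell_mid n i)\<bar> \<le> 5 * C * L * (1 / real n) ^ 4"
proof -
  define h where "h = 1 / real n"
  let ?z = "rep_linf (abs_linf x - Y)"
  let ?m = "cell_mid n i"
  have h: "0 \<le> h" "h \<le> 1" using n by (auto simp: h_def)
  have d: "1 / (2 * real n) = h / 2" by (simp add: h_def)
  note CL = mult_nonneg_nonneg[OF C_nonneg L]
  have in01: "cell n j \<subseteq> {0..1}" if "j \<in> {1..n}" for j by (rule cell_subset_unit[OF that])
  have m: "?m \<in> {0..1}" using cell_mid_shift(3)[of 0 n i] in01[OF i] by auto
  note int = integrable_mult_ess_bounded[OF continuous_snd ess_bounded_rep_linf, of _ "abs_linf x - Y"]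
  have pm: "cell_mid n j + w \<in> {0..1}" "cell_mid n j - w \<in> {0..1}"
    if "j \<in> {1..n}" "w \<in> {0..1 / (2 * real n)}" for j w
    using cell_mid_shift[OF that(2), of j] in01[OF that(1)] by auto
  have ES': "\<bar>x (cell_mid n j - w) - x (cell_mid n j)\<bar> \<le> L * h \<and>
      \<bar>x (cell_mid n j + w) + x (cell_mid n j - w) - 2 * x (cell_mid n j)\<bar> \<le> L * h\<^sup>2"
    if "j \<in> {1..n}" "w \<in> {0..1 / (2 * real n)}" for j w
    using ES[OF that] by (simp add: h_def)
  {
    fix s assume s: "s \<in> cell n i"
    then have s01: "s \<in> {0..1}" using in01[OF i] by auto
    have sm: "\<bar>s - ?m\<bar> \<le> h" using s h by (auto simp: cell_eq_mid d)
    define F where "F t = \<kappa> s t - \<kappa> ?m t" for t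
    have F: "continuous_on {0..1} F"
      unfolding F_def by (intro continuous_on_diff continuous_snd s01 m)
    have "fredholm \<kappa> ?z s - fredholm \<kappa> ?z ?m = midpoint_defect n F x"
      unfolding fredholm_diff_eq[OF continuous_snd[OF s01] continuous_snd[OF m] ess_bounded_rep_linf]
      using integral_interpolation_error[OF n x F] by (simp add: F_def)
    moreover have "\<bar>midpoint_defect n F x\<bar>
      \<le> (C * h * (L * h\<^sup>2) + C * h * h * (L * h)) + (1 / real n) * (C * h * (L * h\<^sup>2) + 2 * C * h * (L * h))"
    proof (rule midpoint_defect_bound[OF n F x(1) i])
      have Fb: "\<bar>F t\<bar> \<le> C * h" if "t \<in> {0..1}" for t
        using lipschitz_fst[OF s01 m that] mult_left_mono[OF sm C_nonneg] by (simp add: F_def)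
      show "\<bar>F (?m + w)\<bar> \<le> C * h \<and> \<bar>F (?m + w) - F (?m - w)\<bar> \<le> 2 * C * h"
        if "w \<in> {0..1 / (2 * real n)}" for w
        using Fb[OF pm(1)[OF i that]] Fb[OF pm(2)[OF i that]] by linarith
      fix j w assume j: "j \<in> {1..n}" "j \<noteq> i" and w: "w \<in> {0..1 / (2 * real n)}"
      let ?t = "cell_mid n j + w" and ?t' = "cell_mid n j - w"
      \<comment> \<open>The first arguments lie in cell \<open>i\<close> and the second ones in
        another cell, so all four points are on the same side of the diagonal.\<close>
      have "max ?t ?t' \<le> min s ?m \<or> max s ?m \<le> min ?t ?t'"
        using cells_ordered[of _ n i _ j] cells_ordered[of _ n j _ i] cell_mid_shift[OF w] s j(2)
        by (cases "i < j") auto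
      then have "\<bar>\<kappa> s ?t - \<kappa> ?m ?t - \<kappa> s ?t' + \<kappa> ?m ?t'\<bar> \<le> C * \<bar>s - ?m\<bar> * \<bar>?t - ?t'\<bar>"
        using s01 m pm[OF j(1) w] by (intro mixed_difference) auto
      also have "\<dots> \<le> C * h * h"
        using sm w h C_nonneg by (intro mult_mono mult_left_mono) (auto simp: d)
      finally show "\<bar>F ?t\<bar> \<le> C * h \<and> \<bar>F ?t - F ?t'\<bar> \<le> C * h * h"
        using Fb[OF pm(1)[OF j(1) w]] by (simp add: F_def algebra_simps)
    qed (use ES' C_nonneg h in auto)
    moreover have "\<dots> = C * L * (4 * h ^ 3) + C * L * h ^ 4"
      unfolding h_def[symmetric] by (simp add: algebra_simps power2_eq_square power3_eq_cube power4_eq_xxxx)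
    moreover have "C * L * h ^ 4 \<le> C * L * h ^ 3"
      using h CL by (intro mult_left_mono power_decreasing) auto
    ultimately show "\<bar>fredholm \<kappa> ?z s - fredholm \<kappa> ?z ?m\<bar> \<le> 5 * C * L * (1 / real n) ^ 3"
      unfolding h_def[symmetric] by simp
  next
    fix v assume v: "v \<in> {0..1 / (2 * real n)}"
    have vh: "0 \<le> v" "v \<le> h / 2" using v by (auto simp: d)
    have md: "0 \<le> ?m - h / 2" "?m + h / 2 \<le> 1"
      using pm[OF i, of "h / 2"] h d by auto
    define F where "F t = second_diff \<kappa> ?m v t" for t
    have F: "continuous_on {0..1} F"
      unfolding F_def second_diff_def
      by (intro continuous_on_diff continuous_on_add continuous_on_mult continuous_on_const
          continuous_snd pm[OF i v] m)
    have "fredholm \<kappa> ?z (?m + v) + fredholm \<kappa> ?z (?m - v) - 2 * fredholm \<kappa> ?z ?m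
        = (\<integral>t. F t * ?z t \<partial>unit_leb)"
      using int[OF pm(1)[OF i v]] int[OF pm(2)[OF i v]] int[OF m]
      by (simp add: F_def second_diff_def fredholm_def algebra_simps)
    also have "\<dots> = midpoint_defect n F x"
      by (rule integral_interpolation_error[OF n x F])
    finally have eq: "fredholm \<kappa> ?z (?m + v) + fredholm \<kappa> ?z (?m - v) - 2 * fredholm \<kappa> ?z ?m
        = midpoint_defect n F x" .
    have v2: "C * v\<^sup>2 \<le> C * h\<^sup>2"
      using vh h C_nonneg by (intro mult_left_mono power_mono) auto
    have "\<bar>midpoint_defect n F x\<bar>
      \<le> (C * h\<^sup>2 * (L * h\<^sup>2) + C * h\<^sup>2 * h * (L * h)) + (1 / real n) * (2 * C * h * (L * h\<^sup>2) + C * h\<^sup>2 * (L * h))"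
    proof (rule midpoint_defect_bound[OF n F x(1) i])
      \<comment> \<open>In the cell of the diagonal the kink leaves \<open>F\<close> only of order
        \<open>h\<close>, but its odd part about the midpoint is of order \<open>h\<^sup>2\<close>.
        Together with the single factor \<open>1 / real n\<close> this keeps the total at order
        \<open>h ^ 4\<close>.\<close>
      show "\<bar>F (?m + w)\<bar> \<le> 2 * C * h \<and> \<bar>F (?m + w) - F (?m - w)\<bar> \<le> C * h\<^sup>2"
        if w: "w \<in> {0..1 / (2 * real n)}" for w
      proof
        let ?t = "?m + w"
        have "C * v \<le> C * h" using vh h C_nonneg by (intro mult_left_mono) auto
        then show "\<bar>F ?t\<bar> \<le> 2 * C * h"
          using lipschitz_fst[OF pm(1)[OF i v] m pm(1)[OF i w]] lipschitz_fst[OF pm(2)[OF i v] m pm(1)[OF i w]] vh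
          unfolding F_def second_diff_def by simp
        have "\<bar>F (?m + w) - F (?m - w)\<bar> \<le> C * (h / 2)\<^sup>2"
          unfolding F_def using w by (intro second_diff_almost_even md vh) (auto simp: d)
        also have "\<dots> \<le> C * h\<^sup>2"
          using h C_nonneg by (intro mult_left_mono power_mono) auto
        finally show "\<bar>F (?m + w) - F (?m - w)\<bar> \<le> C * h\<^sup>2" .
      qed
      fix j w assume j: "j \<in> {1..n}" "j \<noteq> i" and w: "w \<in> {0..1 / (2 * real n)}"
      let ?t = "cell_mid n j + w" and ?t' = "cell_mid n j - w"
      have sep: "max ?t ?t' \<le> ?m - v \<or> ?m + v \<le> min ?t ?t'"
        using cells_ordered[of _ n i _ j] cells_ordered[of _ n j _ i]
          cell_mid_shift[OF w] cell_mid_shift[OF v] j(2)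
        by (cases "i < j") auto
      have mv: "0 \<le> ?m - v" "?m + v \<le> 1" using pm[OF i v] by auto
      have "\<bar>F ?t\<bar> \<le> C * v\<^sup>2"
        unfolding F_def using sep by (intro second_diff_off_diagonal vh mv pm[OF j(1) w]) auto
      moreover have "\<bar>F ?t - F ?t'\<bar> \<le> C * v\<^sup>2 * \<bar>?t - ?t'\<bar>"
        unfolding F_def by (intro second_diff_lipschitz vh mv pm[OF j(1) w] sep)
      moreover have "C * v\<^sup>2 * \<bar>?t - ?t'\<bar> \<le> C * h\<^sup>2 * h"
        using w h C_nonneg by (intro mult_mono v2) (auto simp: d)
      ultimately show "\<bar>F ?t\<bar> \<le> C * h\<^sup>2 \<and> \<bar>F ?t - F ?t'\<bar> \<le> C * h\<^sup>2 * h"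
        using v2 by linarith
    qed (use ES' C_nonneg h in auto)
    also have "\<dots> = 5 * C * L * h ^ 4"
      unfolding h_def[symmetric] by (simp add: algebra_simps power2_eq_square power4_eq_xxxx)
    finally show "\<bar>fredholm \<kappa> ?z (?m + v) + fredholm \<kappa> ?z (?m - v) - 2 * fredholm \<kappa> ?z ?m\<bar>
        \<le> 5 * C * L * (1 / real n) ^ 4"
      unfolding eq h_def[symmetric] .
  }
qed

text \<open>On each cell \<open>Z - Q Z\<close> is a continuous function \<open>g\<close> minus its
  midpoint value, so the first bound of \<open>midpoint_defect_near\<close> applies directly. For
  the second, \<open>g\<close> is itself paired with the kernel: its differences of order
  \<open>h ^ 3\<close> meet a kernel variation of order \<open>h\<close>, its second differences of
  order \<open>h ^ 4\<close> a bounded kernel.\<close>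

lemma midpoint_error_bounds:
  fixes Q :: "linf \<Rightarrow>\<^sub>L linf"
  assumes n: "1 \<le> n" and Q: "\<And>y. continuous_on {0..1} y \<Longrightarrow> is_interpolant 0 n y (Q (abs_linf y))"
    and x: "continuous_on {0..1} x" and L: "0 \<le> L"
    and ES: "\<And>j w. j \<in> {1..n} \<Longrightarrow> w \<in> {0..1 / (2 * real n)} \<Longrightarrow>
      \<bar>x (cell_mid n j - w) - x (cell_mid n j)\<bar> \<le> L * (1 / real n) \<and>
      \<bar>x (cell_mid n j + w) + x (cell_mid n j - w) - 2 * x (cell_mid n j)\<bar> \<le> L * (1 / real n)\<^sup>2"
  defines "Z \<equiv> fredholm_linf \<kappa> (abs_linf x - Q (abs_linf x))"
  shows "norm (Z - Q Z) \<le> 5 * C * L * (1 / real n) ^ 3"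
    and "norm (fredholm_linf \<kappa> (Z - Q Z)) \<le> 20 * C\<^sup>2 * L * (1 / real n) ^ 4"
proof -
  define h where "h = 1 / real n"
  have h: "0 \<le> h" "h \<le> 1" using n by (auto simp: h_def)
  have d: "1 / (2 * real n) = h / 2" by (simp add: h_def)
  define g where "g = fredholm \<kappa> (rep_linf (abs_linf x - Q (abs_linf x)))"
  have cg: "continuous_on {0..1} g" unfolding g_def by (rule continuous_fredholm)
  have Z: "Z = abs_linf g" unfolding Z_def g_def fredholm_linf_def ..
  note near = midpoint_defect_near[OF n x Q[OF x] L ES, folded g_def h_def]
  have Y: "is_interpolant 0 n g (Q Z)" unfolding Z by (rule Q[OF cg])
  have "AE t in unit_leb. \<forall>j\<in>{1..n}. t \<in> cell n j \<longrightarrow> rep_linf (Q Z) t = g (cell_mid n j)"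
    using midpoint_interpolant_AE[OF Y] by (intro AE_finite_allI) auto
  moreover have "AE t in unit_leb. t \<in> {0..1}" by (rule AE_unit_lebI)
  ultimately have "AE t in unit_leb. \<bar>rep_linf (Z - Q Z) t\<bar> \<le> 5 * C * L * h ^ 3"
    using rep_linf_diff_AE[of Z "Q Z"] rep_abs_linf_AE[OF ess_bounded_continuous[OF cg], folded Z]
  proof eventually_elim
    case (elim t)
    obtain j where j: "j \<in> {1..n}" "t \<in> cell n j" using obtain_cell[OF n elim(2)] .
    with elim near(1)[of j t] show ?case by auto
  qed
  then show "norm (Z - Q Z) \<le> 5 * C * L * (1 / real n) ^ 3"
    unfolding h_def by (rule norm_linf_le)
  show "norm (fredholm_linf \<kappa> (Z - Q Z)) \<le> 20 * C\<^sup>2 * L * (1 / real n) ^ 4"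
    unfolding fredholm_linf_def
  proof (intro norm_abs_linf_le ess_bounded_fredholm AE_unit_lebI)
    fix s :: real assume s: "s \<in> {0..1}"
    \<comment> \<open>The kernel at fixed \<open>s\<close> satisfies the same bounds on every cell;
      the exceptional index is set to 1 only to instantiate the lemma.\<close>
    have n1: "1 \<in> {1..n}" using n by simp
    have kb: "\<bar>\<kappa> s (cell_mid n j + w)\<bar> \<le> C \<and> \<bar>\<kappa> s (cell_mid n j + w) - \<kappa> s (cell_mid n j - w)\<bar> \<le> C * h"
      if j: "j \<in> {1..n}" and w: "w \<in> {0..1 / (2 * real n)}" for j w
    proof
      have pm: "cell_mid n j + w \<in> {0..1}" "cell_mid n j - w \<in> {0..1}"
        using cell_mid_shift[OF w] cell_subset_unit[OF j] by blast+
      then show "\<bar>\<kappa> s (cell_mid n j + w)\<bar> \<le> C" using bounded[OF s] by blast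
      have "C * \<bar>cell_mid n j + w - (cell_mid n j - w)\<bar> \<le> C * h"
        using w C_nonneg by (intro mult_left_mono) (auto simp: d)
      then show "\<bar>\<kappa> s (cell_mid n j + w) - \<kappa> s (cell_mid n j - w)\<bar> \<le> C * h"
        using lipschitz_snd[OF s pm] by linarith
    qed
    have ES': "\<bar>g (cell_mid n j - w) - g (cell_mid n j)\<bar> \<le> 5 * C * L * h ^ 3 \<and>
      \<bar>g (cell_mid n j + w) + g (cell_mid n j - w) - 2 * g (cell_mid n j)\<bar> \<le> 5 * C * L * h ^ 4"
      if j: "j \<in> {1..n}" and w: "w \<in> {0..1 / (2 * real n)}" for j w
      using near(1)[OF _ _ j cell_mid_shift(2)[OF w]] near(2)[OF _ _ j, of w] w by auto
    have "fredholm \<kappa> (rep_linf (Z - Q Z)) s = midpoint_defect n (\<kappa> s) g"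
      unfolding fredholm_def Z
      by (rule integral_interpolation_error[OF n cg Q[OF cg] continuous_snd[OF s]])
    also have "\<bar>\<dots>\<bar> \<le> (C * (5 * C * L * h ^ 4) + C * h * (5 * C * L * h ^ 3))
      + (1 / real n) * (C * (5 * C * L * h ^ 4) + C * h * (5 * C * L * h ^ 3))"
      by (rule midpoint_defect_bound[OF n continuous_snd[OF s] cg n1]) (use kb n1 ES' C_nonneg h in auto)
    also have "\<dots> = (1 + h) * (10 * C\<^sup>2 * L * h ^ 4)"
      unfolding h_def[symmetric] by (simp add: algebra_simps power2_eq_square power3_eq_cube power4_eq_xxxx)
    also have "\<dots> \<le> 2 * (10 * C\<^sup>2 * L * h ^ 4)"
      using h L by (intro mult_right_mono) auto
    finally show "\<bar>fredholm \<kappa> (rep_linf (Z - Q Z)) s\<bar> \<le> 20 * C\<^sup>2 * L * (1 / real n) ^ 4"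
      by (simp add: h_def)
  qed
qed

end

section \<open>The modified collocation equation\<close>

lemma smooth_difference_bounds:
  assumes "Ck_on_unit 2 \<phi>"
  obtains L where "0 \<le> L" "\<And>a w. 0 \<le> w \<Longrightarrow> a - w \<in> {0..1} \<Longrightarrow> a + w \<in> {0..1} \<Longrightarrow>
    \<bar>\<phi> (a - w) - \<phi> a\<bar> \<le> L * w \<and> \<bar>\<phi> (a + w) + \<phi> (a - w) - 2 * \<phi> a\<bar> \<le> L * w\<^sup>2"
proof -
  obtain D where D0: "\<forall>s\<in>{0..1}. D 0 s = \<phi> s"
    and D: "\<And>i s. i < 2 \<Longrightarrow> s \<in> {0..1} \<Longrightarrow> (D i has_real_derivative D (Suc i) s) (at s within {0..1})"
    and cont: "\<forall>i\<le>2. continuous_on {0..1} (D i)"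
    using assms unfolding Ck_on_unit_def by blast
  have bd: "\<exists>b. \<forall>s\<in>{0..1}. \<bar>D i s\<bar> \<le> b" if "i \<le> 2" for i
  proof -
    have "bounded (D i ` {0..1})"
      using cont that by (intro compact_imp_bounded compact_continuous_image) auto
    then show ?thesis by (simp add: bounded_iff)
  qed
  obtain b1 where b1: "\<forall>s\<in>{0..1}. \<bar>D 1 s\<bar> \<le> b1" using bd[of 1] by auto
  obtain b2 where b2: "\<forall>s\<in>{0..1}. \<bar>D 2 s\<bar> \<le> b2" using bd[of 2] by auto
  have nn: "0 \<le> b1" "0 \<le> b2"
    using b1[rule_format, of 0] b2[rule_format, of 0] by auto
  \<comment> \<open>One constant for both: \<open>b1\<close> bounds the first difference by the mean
    value inequality, \<open>2 * b2\<close> the two Taylor remainders in the second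
    difference.\<close>
  have "\<bar>\<phi> (a - w) - \<phi> a\<bar> \<le> (b1 + 2 * b2) * w \<and>
      \<bar>\<phi> (a + w) + \<phi> (a - w) - 2 * \<phi> a\<bar> \<le> (b1 + 2 * b2) * w\<^sup>2"
    if w: "0 \<le> w" "a - w \<in> {0..1}" "a + w \<in> {0..1}" for a w
  proof
    have a: "a \<in> {0..1}" using w by auto
    have "norm (D 0 (a - w) - D 0 a) \<le> b1 * norm (a - w - a)"
      by (rule field_differentiable_bound[where S = "{0..1}" and f' = "D 1"])
        (use D[of 0] b1 a w in auto)
    moreover have "0 \<le> b2 * w" using nn w by simp
    ultimately show "\<bar>\<phi> (a - w) - \<phi> a\<bar> \<le> (b1 + 2 * b2) * w"
      using D0 a w by (simp add: algebra_simps)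
    have T: "\<bar>D 0 y - D 0 a - D 1 a * (y - a)\<bar> \<le> b2 * (y - a)\<^sup>2" if "y \<in> {0..1}" for y
      by (rule taylor1_bound[where S = "{0..1}" and f'' = "D 2"])
        (use D[of 0] D[of 1] b2 a that in \<open>auto simp: numeral_2_eq_2\<close>)
    have "0 \<le> b1 * w\<^sup>2" using nn by simp
    then show "\<bar>\<phi> (a + w) + \<phi> (a - w) - 2 * \<phi> a\<bar> \<le> (b1 + 2 * b2) * w\<^sup>2"
      using T[OF w(2)] T[OF w(3)] D0 a w by (simp add: algebra_simps)
  qed
  with nn that[of "b1 + 2 * b2"] show ?thesis by auto
qed

lemma mod_colloc_defect:
  fixes Q :: "linf \<Rightarrow>\<^sub>L linf"
  assumes "linear K"
  shows "K X - mod_colloc_op K Q X = K (X - Q X) - Q (K (X - Q X))"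
  by (simp add: mod_colloc_op_def linear_diff[OF assms] blinfun.diff_right algebra_simps)

section \<open>Stability, unique solvability and error equations\<close>

context green_kernel
begin

abbreviation K :: "linf \<Rightarrow> linf" where "K \<equiv> fredholm_linf \<kappa>"

text \<open>The product \<open>(I - Q) K (I - Q)\<close>, in which smallness is visible;
  \<open>defect_eq\<close> recovers the difference of \<open>K\<close> and the modified operator,
  which enters the equations.\<close>

definition defect :: "(linf \<Rightarrow>\<^sub>L linf) \<Rightarrow> linf \<Rightarrow> linf"
  where "defect Q X = K (X - Q X) - Q (K (X - Q X))"

lemmas K_diff = linear_diff[OF linear_fredholm_linf]

lemma norm_defect_le:
  fixes Q :: "linf \<Rightarrow>\<^sub>L linf"
  assumes n: "1 \<le> n" and Q: "\<And>Y. Y \<in> pw_poly_space r n \<Longrightarrow> Q Y = Y" "norm Q \<le> M"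
  shows "norm (defect Q X) \<le> (1 + M)\<^sup>2 * C * (1 / real n) * norm X"
proof -
  have M: "0 \<le> M" using Q(2) norm_ge_zero[of Q] by linarith
  have "norm (Q X) \<le> M * norm X"
    using norm_blinfun[of Q X] mult_right_mono[OF Q(2) norm_ge_zero[of X]] by linarith
  then have 1: "norm (X - Q X) \<le> (1 + M) * norm X"
    using norm_triangle_ineq4[of X "Q X"] by (simp add: algebra_simps)
  have "norm (defect Q X) \<le> (1 + M) * (C * (1 / real n) * norm (X - Q X))"
    unfolding defect_def by (rule piecewise_constant_error[OF n Q])
  also have "\<dots> \<le> (1 + M) * (C * (1 / real n) * ((1 + M) * norm X))"
    using M C_nonneg by (intro mult_left_mono 1) auto
  finally show ?thesis by (simp add: power2_eq_square mult_ac)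
qed

lemmas mod_colloc_diff = linear_diff[OF mod_colloc_op_linear[OF linear_fredholm_linf]]

lemma defect_eq: "defect Q X = K X - mod_colloc_op K Q X"
  unfolding defect_def by (rule mod_colloc_defect[OF linear_fredholm_linf, symmetric])

text \<open>\<open>X - K X\<close> differs from \<open>X - mod_colloc_op K Q X\<close> by the
  defect, which contributes at most half of \<open>norm X\<close>. Absorbing it on the left doubles
  the constant.\<close>

lemma mod_colloc_stable:
  fixes Q :: "linf \<Rightarrow>\<^sub>L linf"
  assumes n: "1 \<le> n" and Q: "\<And>Y. Y \<in> pw_poly_space r n \<Longrightarrow> Q Y = Y" "norm Q \<le> M"
    and c: "0 < c" "\<And>X. norm X \<le> c * norm (X - K X)"
    and small: "c * ((1 + M)\<^sup>2 * C * (1 / real n)) \<le> 1 / 2"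
  shows "norm X \<le> 2 * c * norm (X - mod_colloc_op K Q X)"
proof -
  have "X - K X = (X - mod_colloc_op K Q X) - defect Q X"
    by (simp add: defect_eq)
  then have "norm (X - K X) \<le> norm (X - mod_colloc_op K Q X) + norm (defect Q X)"
    by (metis norm_triangle_ineq4)
  also have "norm (defect Q X) \<le> (1 + M)\<^sup>2 * C * (1 / real n) * norm X"
    by (rule norm_defect_le[OF n Q])
  finally have le: "norm (X - K X) \<le> norm (X - mod_colloc_op K Q X) + (1 + M)\<^sup>2 * C * (1 / real n) * norm X"
    by simp
  have "norm X \<le> c * (norm (X - mod_colloc_op K Q X) + (1 + M)\<^sup>2 * C * (1 / real n) * norm X)"
    by (rule order_trans[OF c(2) mult_left_mono[OF le]]) (use c(1) in simp)
  also have "\<dots> = c * norm (X - mod_colloc_op K Q X) + c * ((1 + M)\<^sup>2 * C * (1 / real n)) * norm X"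
    by (simp only: distrib_left mult.assoc)
  also have "c * ((1 + M)\<^sup>2 * C * (1 / real n)) * norm X \<le> 1 / 2 * norm X"
    by (intro mult_right_mono small) simp
  finally show ?thesis by simp
qed

lemma mod_colloc_unique_solution:
  fixes Q :: "linf \<Rightarrow>\<^sub>L linf"
  assumes n: "1 \<le> n" and range: "range Q \<subseteq> pw_poly_space r n"
    and stable: "\<And>X. norm X \<le> c * norm (X - mod_colloc_op K Q X)"
  shows "\<exists>!X. X - mod_colloc_op K Q X = Y"
proof -
  have inj: "X = 0" if "X - mod_colloc_op K Q X = 0" for X
    using stable[of X] that by simp
  obtain X where X: "X - mod_colloc_op K Q X = Y"
    using mod_colloc_op_surj[OF linear_fredholm_linf n range] inj by blast
  moreover have "X' = X" if "X' - mod_colloc_op K Q X' = Y" for X'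
  proof -
    have "(X' - X) - mod_colloc_op K Q (X' - X) = (X' - mod_colloc_op K Q X') - (X - mod_colloc_op K Q X)"
      unfolding mod_colloc_diff by simp
    then show ?thesis using inj[of "X' - X"] X that by simp
  qed
  ultimately show ?thesis by blast
qed

text \<open>The residual of the exact solution in the modified equation is
  \<open>defect Q \<Phi>\<close>; stability turns it into an error bound.\<close>

lemma mod_colloc_error:
  fixes Q :: "linf \<Rightarrow>\<^sub>L linf"
  assumes stable: "\<And>X. norm X \<le> c' * norm (X - mod_colloc_op K Q X)"
    and sol: "Y - mod_colloc_op K Q Y = F" "\<Phi> - K \<Phi> = F"
  shows "norm (\<Phi> - Y) \<le> c' * norm (defect Q \<Phi>)"
proof -
  have "(\<Phi> - Y) - mod_colloc_op K Q (\<Phi> - Y) = (\<Phi> - mod_colloc_op K Q \<Phi>) - F"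
    unfolding sol(1)[symmetric] mod_colloc_diff by simp
  also have "\<dots> = defect Q \<Phi>"
    unfolding sol(2)[symmetric] defect_eq by simp
  finally show ?thesis using stable[of "\<Phi> - Y"] by simp
qed

text \<open>The left side has \<open>I - K\<close> rather than the modified operator because
  \<open>K\<close> commutes with it: applying \<open>K\<close> gives an equation for the iterated
  error.\<close>

lemma iterated_error_identity:
  fixes Q :: "linf \<Rightarrow>\<^sub>L linf"
  assumes sol: "Y - mod_colloc_op K Q Y = F" "\<Phi> - K \<Phi> = F"
  shows "(\<Phi> - Y) - K (\<Phi> - Y) = defect Q \<Phi> - defect Q (\<Phi> - Y)"
proof -
  have "(\<Phi> - Y) - K (\<Phi> - Y) = (\<Phi> - K \<Phi>) - Y + K Y"
    by (simp add: K_diff)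
  also have "\<dots> = K Y - mod_colloc_op K Q Y"
    unfolding sol(2) sol(1)[symmetric] by simp
  also have "\<dots> = defect Q \<Phi> - defect Q (\<Phi> - Y)"
    by (simp add: defect_eq mod_colloc_diff K_diff)
  finally show ?thesis .
qed

lemma abs_linf_solution:
  assumes "continuous_on {0..1} \<phi>" "continuous_on {0..1} f"
    and "\<forall>s\<in>{0..1}. \<phi> s - fredholm \<kappa> \<phi> s = f s"
  shows "abs_linf \<phi> - K (abs_linf \<phi>) = abs_linf f"
proof -
  note b = ess_bounded_continuous[OF assms(1)]
  have "fredholm \<kappa> (rep_linf (abs_linf \<phi>)) s = fredholm \<kappa> \<phi> s" if "s \<in> {0..1}" for s
    by (rule fredholm_cong_AE[OF rep_abs_linf_AE[OF b] ess_bounded_rep_linf b that])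
  then show ?thesis
    unfolding fredholm_linf_def abs_linf_diff[OF b ess_bounded_fredholm] using assms(3)
    by (intro abs_linf_eqI ess_bounded_diff b ess_bounded_fredholm ess_bounded_continuous[OF assms(2)]
        AE_unit_lebI) auto
qed

end

section \<open>Assembly of the convergence orders\<close>

theorem theorem5:
  fixes r \<alpha> :: nat
    and \<kappa> :: "real \<Rightarrow> real \<Rightarrow> real"
    and f \<phi> :: "real \<Rightarrow> real"
    and P :: "nat \<Rightarrow> linf \<Rightarrow>\<^sub>L linf"
  assumes "\<alpha> \<ge> 1" and "r \<ge> 1 \<longrightarrow> \<alpha> > r"
    and "green_type \<alpha> \<kappa>"
    and "\<not> eigenvalue_of (fredholm_linf \<kappa>) 1"
    and "continuous_on {0..1} f"
    and "\<forall>s\<in>{0..1}. \<phi> s - fredholm \<kappa> \<phi> s = f s"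
    and "Ck_on_unit (2 * r + 2) \<phi>"
    and "interp_projections r P"
  shows "(\<forall>\<^sub>F n in sequentially. \<exists>!x. x - mod_colloc_op (fredholm_linf \<kappa>) (P n) x = abs_linf f) \<and>
    (\<lambda>n. norm (abs_linf \<phi> - mod_colloc_sol (fredholm_linf \<kappa>) (P n) (abs_linf f)))
      \<in> O(\<lambda>n. (1 / real n) ^ (if r \<ge> 1 then 2 * r + 2 else 3)) \<and>
    (\<lambda>n. norm (abs_linf \<phi> - iter_mod_colloc_sol (fredholm_linf \<kappa>) (P n) (abs_linf f)))
      \<in> O(\<lambda>n. (1 / real n) ^ (if r \<ge> 1 then 2 * r + 3 else 4))"
proof -
  obtain C where "green_kernel \<kappa> C" using green_kernel_exists[OF assms(3)] .
  then interpret green_kernel \<kappa> C .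
  obtain c where c: "0 < c" "\<And>X. norm X \<le> c * norm (X - K X)"
    by (rule fredholm_bounded_below[OF assms(4)]) blast
  obtain M where M: "\<And>n. 1 \<le> n \<Longrightarrow> norm (P n) \<le> M"
    using assms(8) unfolding interp_projections_def by blast
  have P: "range (P n) \<subseteq> pw_poly_space r n" "\<And>Y. Y \<in> pw_poly_space r n \<Longrightarrow> P n Y = Y"
    "\<And>y. continuous_on {0..1} y \<Longrightarrow> is_interpolant r n y (P n (abs_linf y))" if "1 \<le> n" for n
    using assms(8) that unfolding interp_projections_def by blast+
  have M0: "0 \<le> M" using M[of 1] norm_ge_zero[of "P 1"] by linarith
  define \<Phi> where "\<Phi> = abs_linf \<phi>"
  define Y where "Y n = mod_colloc_sol K (P n) (abs_linf f)" for n
  note c\<phi> = Ck_on_unit_continuous[OF assms(7)]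
  have \<Phi>: "\<Phi> - K \<Phi> = abs_linf f"
    unfolding \<Phi>_def by (rule abs_linf_solution[OF c\<phi> assms(5,6)])
  define D where "D = (1 + M)\<^sup>2 * C"
  have D0: "0 \<le> D" using C_nonneg by (simp add: D_def)
  have "(\<lambda>n. c * (D * (1 / real n))) \<longlonglongrightarrow> c * (D * 0)"
    by (intro tendsto_intros lim_1_over_n)
  then have "\<forall>\<^sub>F n in sequentially. c * (D * (1 / real n)) < 1 / 2"
    by (rule order_tendstoD) simp
  \<comment> \<open>This is the threshold demanded by \<open>mod_colloc_stable\<close>; all
    estimates below hold for every such \<open>n\<close>.\<close>
  then have large: "\<forall>\<^sub>F n in sequentially. 1 \<le> n \<and> c * (D * (1 / real n)) \<le> 1 / 2"
    using eventually_ge_at_top[of 1] by eventually_elim simp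
  have ex1: "\<exists>!x. x - mod_colloc_op K (P n) x = abs_linf f"
    and err: "norm (\<Phi> - Y n) \<le> 2 * c * norm (defect (P n) \<Phi>)"
    and id: "(\<Phi> - Y n) - K (\<Phi> - Y n) = defect (P n) \<Phi> - defect (P n) (\<Phi> - Y n)"
    and iter: "\<Phi> - iter_mod_colloc_sol K (P n) (abs_linf f) = K (\<Phi> - Y n)"
    if n: "1 \<le> n" "c * (D * (1 / real n)) \<le> 1 / 2" for n
  proof -
    note st = mod_colloc_stable[OF n(1) P(2)[OF n(1)] M[OF n(1)] c n(2)[unfolded D_def]]
    show ex1: "\<exists>!x. x - mod_colloc_op K (P n) x = abs_linf f"
      by (rule mod_colloc_unique_solution[OF n(1) P(1)[OF n(1)] st])
    have Y: "Y n - mod_colloc_op K (P n) (Y n) = abs_linf f"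
      unfolding Y_def mod_colloc_sol_def by (rule theI'[OF ex1])
    show "norm (\<Phi> - Y n) \<le> 2 * c * norm (defect (P n) \<Phi>)"
      by (rule mod_colloc_error[OF st Y \<Phi>])
    show "(\<Phi> - Y n) - K (\<Phi> - Y n) = defect (P n) \<Phi> - defect (P n) (\<Phi> - Y n)"
      by (rule iterated_error_identity[OF Y \<Phi>])
    show "\<Phi> - iter_mod_colloc_sol K (P n) (abs_linf f) = K (\<Phi> - Y n)"
      unfolding iter_mod_colloc_sol_def Y_def K_diff by (simp add: \<Phi>[symmetric])
  qed
  have "\<exists>A B. \<forall>n. 1 \<le> n \<and> c * (D * (1 / real n)) \<le> 1 / 2 \<longrightarrow>
    norm (\<Phi> - Y n) \<le> A * (1 / real n) ^ (if r \<ge> 1 then 2 * r + 2 else 3) \<and>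
    norm (K (\<Phi> - Y n)) \<le> B * (1 / real n) ^ (if r \<ge> 1 then 2 * r + 3 else 4)"
  proof (cases "1 \<le> r")
    case True
    obtain B where B: "0 \<le> B" "\<And>n. 1 \<le> n \<Longrightarrow> \<exists>p. (\<forall>j\<in>{1..n}. degree (p j) \<le> 2 * r) \<and>
      (\<forall>j\<in>{1..n}. \<forall>t\<in>cell n j. \<bar>\<phi> t - poly (p j) t\<bar> \<le> B * (1 / real n) ^ (2 * r + 1))"
      using smooth_piecewise_taylor[OF assms(7)] by blast
    \<comment> \<open>From left to right: stability, the piecewise linear error of the outer
      projection (two powers of \<open>h\<close>), and the Taylor error of the inner one
      (\<open>2 * r + 1\<close> powers).\<close>
    define A where "A = 2 * c * ((1 + M) * (2 * C * ((1 + M) * B)))"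
    have A0: "0 \<le> A" using c(1) M0 B(1) C_nonneg by (simp add: A_def)
    show ?thesis
    proof (rule exI[of _ A], rule exI[of _ "C * A"], intro allI impI)
      fix n assume n: "1 \<le> n \<and> c * (D * (1 / real n)) \<le> 1 / 2"
      define h where "h = 1 / real n"
      have h: "0 \<le> h" "h \<le> 1" using n by (auto simp: h_def)
      note Pn = P(2)[of n, OF conjunct1[OF n]] M[OF conjunct1[OF n]]
      obtain p where p: "\<And>j. j \<in> {1..n} \<Longrightarrow> degree (p j) \<le> 2 * r"
        "\<And>j t. j \<in> {1..n} \<Longrightarrow> t \<in> cell n j \<Longrightarrow> \<bar>\<phi> t - poly (p j) t\<bar> \<le> B * h ^ (2 * r + 1)"
        using B(2)[OF conjunct1[OF n]] unfolding h_def by blast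
      have \<Phi>err: "norm (\<Phi> - P n \<Phi>) \<le> (1 + M) * (B * h ^ (2 * r + 1))"
        unfolding \<Phi>_def by (rule projection_error[OF conjunct1[OF n] Pn ess_bounded_continuous[OF c\<phi>] p])
      have "norm (defect (P n) \<Phi>) \<le> (1 + M) * (2 * C * h\<^sup>2 * norm (\<Phi> - P n \<Phi>))"
        unfolding defect_def h_def by (rule piecewise_linear_error[OF conjunct1[OF n] True Pn])
      also have "\<dots> \<le> (1 + M) * (2 * C * h\<^sup>2 * ((1 + M) * (B * h ^ (2 * r + 1))))"
        using M0 C_nonneg by (intro mult_left_mono \<Phi>err) auto
      finally have "2 * c * norm (defect (P n) \<Phi>) \<le> 2 * c * ((1 + M) * (2 * C * h\<^sup>2 * ((1 + M) * (B * h ^ (2 * r + 1)))))"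
        using c(1) by (intro mult_left_mono) auto
      also have "\<dots> = A * h ^ (2 * r + 3)"
        by (simp add: A_def power_add power2_eq_square power3_eq_cube mult_ac)
      finally have e: "norm (\<Phi> - Y n) \<le> A * h ^ (2 * r + 3)"
        using err n by (meson order_trans)
      also have "\<dots> \<le> A * h ^ (2 * r + 2)"
        using A0 h by (intro mult_left_mono power_decreasing) auto
      finally have e': "norm (\<Phi> - Y n) \<le> A * h ^ (2 * r + 2)" .
      \<comment> \<open>The bound \<open>e\<close> already has the order asked of the iterated
        error, so boundedness of \<open>K\<close> suffices.\<close>
      have "norm (K (\<Phi> - Y n)) \<le> C * (A * h ^ (2 * r + 3))"
        using e C_nonneg by (intro order_trans[OF norm_fredholm_linf_le] mult_left_mono)
      with e' True show "norm (\<Phi> - Y n) \<le> A * (1 / real n) ^ (if r \<ge> 1 then 2 * r + 2 else 3) \<and>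
          norm (K (\<Phi> - Y n)) \<le> C * A * (1 / real n) ^ (if r \<ge> 1 then 2 * r + 3 else 4)"
        by (simp add: h_def mult.assoc)
    qed
  next
    case False
    then have r0: "r = 0" by simp
    have "Ck_on_unit 2 \<phi>" using assms(7) r0 by (simp add: numeral_2_eq_2)
    then obtain L where L: "0 \<le> L" "\<And>a w. 0 \<le> w \<Longrightarrow> a - w \<in> {0..1} \<Longrightarrow> a + w \<in> {0..1} \<Longrightarrow>
      \<bar>\<phi> (a - w) - \<phi> a\<bar> \<le> L * w \<and> \<bar>\<phi> (a + w) + \<phi> (a - w) - 2 * \<phi> a\<bar> \<le> L * w\<^sup>2"
      by (rule smooth_difference_bounds) blast
    define A where "A = 2 * c * (5 * C * L)"
    \<comment> \<open>The two summands bound \<open>K\<close> applied to the defect of the solution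
      and to the defect of the error; \<open>c\<close> comes from the lower bound for
      \<open>I - K\<close>.\<close>
    define B where "B = c * (20 * C\<^sup>2 * L + C * (D * A))"
    show ?thesis
    proof (rule exI[of _ A], rule exI[of _ B], intro allI impI)
      fix n assume n: "1 \<le> n \<and> c * (D * (1 / real n)) \<le> 1 / 2"
      define h where "h = 1 / real n"
      have h: "0 \<le> h" "h \<le> 1" using n by (auto simp: h_def)
      note n1 = conjunct1[OF n]
      have ES: "\<bar>\<phi> (cell_mid n j - w) - \<phi> (cell_mid n j)\<bar> \<le> L * (1 / real n) \<and>
        \<bar>\<phi> (cell_mid n j + w) + \<phi> (cell_mid n j - w) - 2 * \<phi> (cell_mid n j)\<bar> \<le> L * (1 / real n)\<^sup>2"
        if j: "j \<in> {1..n}" and w: "w \<in> {0..1 / (2 * real n)}" for j w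
      proof -
        have "1 / (2 * real n) \<le> 1 / real n" using n by (simp add: field_simps)
        then have w': "0 \<le> w" "w \<le> 1 / real n" using w by auto
        then have "L * w \<le> L * (1 / real n)" "L * w\<^sup>2 \<le> L * (1 / real n)\<^sup>2"
          using L(1) by (auto intro!: mult_left_mono power_mono simp del: times_divide_eq_right)
        then show ?thesis
          using L(2)[OF w'(1), of "cell_mid n j"] cell_mid_shift[OF w] cell_subset_unit[OF j] by (meson order_trans subsetD)
      qed
      note mid = midpoint_error_bounds[OF n1 P(3)[OF n1, unfolded r0] c\<phi> L(1) ES, folded \<Phi>_def h_def, folded defect_def]
      have "norm (\<Phi> - Y n) \<le> 2 * c * (5 * C * L * h ^ 3)"
        using mid(1) c(1) n by (intro order_trans[OF err] mult_left_mono) auto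
      then have e: "norm (\<Phi> - Y n) \<le> A * h ^ 3" by (simp add: A_def mult.assoc)
      \<comment> \<open>The error need not be smooth, but its defect gains the general factor
        \<open>h\<close>, which lifts third order to fourth.\<close>
      have "norm (K (defect (P n) (\<Phi> - Y n))) \<le> C * (D * h * norm (\<Phi> - Y n))"
        unfolding D_def h_def
        by (intro order_trans[OF norm_fredholm_linf_le] mult_left_mono C_nonneg
            norm_defect_le[OF n1 P(2)[OF n1] M[OF n1]])
      also have "\<dots> \<le> C * (D * h * (A * h ^ 3))"
        using e C_nonneg D0 h by (intro mult_left_mono) auto
      also have "\<dots> = C * (D * A) * h ^ 4" by (simp add: power3_eq_cube power4_eq_xxxx mult_ac)
      finally have 2: "norm (K (defect (P n) (\<Phi> - Y n))) \<le> C * (D * A) * h ^ 4" .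
      \<comment> \<open>Applying \<open>K\<close> before inverting \<open>I - K\<close> matters: the
        defect of the solution is only of order \<open>h ^ 3\<close>, its image under
        \<open>K\<close> of order \<open>h ^ 4\<close>.\<close>
      have "K (\<Phi> - Y n) - K (K (\<Phi> - Y n)) = K (defect (P n) \<Phi>) - K (defect (P n) (\<Phi> - Y n))"
        using id[of n] n by (metis K_diff)
      then have "norm (K (\<Phi> - Y n)) \<le> c * norm (K (defect (P n) \<Phi>) - K (defect (P n) (\<Phi> - Y n)))"
        using c(2)[of "K (\<Phi> - Y n)"] by simp
      also have "\<dots> \<le> c * (20 * C\<^sup>2 * L * h ^ 4 + C * (D * A) * h ^ 4)"
        using c(1) mid(2) 2 by (intro mult_left_mono order_trans[OF norm_triangle_ineq4] add_mono) auto
      also have "\<dots> = B * h ^ 4" by (simp add: B_def algebra_simps)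
      finally show "norm (\<Phi> - Y n) \<le> A * (1 / real n) ^ (if r \<ge> 1 then 2 * r + 2 else 3) \<and>
          norm (K (\<Phi> - Y n)) \<le> B * (1 / real n) ^ (if r \<ge> 1 then 2 * r + 3 else 4)"
        using e False by (simp add: h_def)
    qed
  qed
  then obtain A B where AB: "\<And>n. 1 \<le> n \<Longrightarrow> c * (D * (1 / real n)) \<le> 1 / 2 \<Longrightarrow>
    norm (\<Phi> - Y n) \<le> A * (1 / real n) ^ (if r \<ge> 1 then 2 * r + 2 else 3) \<and>
    norm (K (\<Phi> - Y n)) \<le> B * (1 / real n) ^ (if r \<ge> 1 then 2 * r + 3 else 4)"
    by blast
  have pow: "\<bar>(1 / real n) ^ k\<bar> = (1 / real n) ^ k" for n k by simp
  have "\<forall>\<^sub>F n in sequentially. \<exists>!x. x - mod_colloc_op K (P n) x = abs_linf f"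
    using large by eventually_elim (use ex1 in blast)
  moreover have "(\<lambda>n. norm (\<Phi> - Y n)) \<in> O(\<lambda>n. (1 / real n) ^ (if r \<ge> 1 then 2 * r + 2 else 3))"
  proof (rule bigoI[where c = A], use large in eventually_elim)
    case (elim n)
    then show ?case unfolding real_norm_def abs_norm_cancel pow using AB[of n] by blast
  qed
  moreover have "(\<lambda>n. norm (\<Phi> - iter_mod_colloc_sol K (P n) (abs_linf f)))
      \<in> O(\<lambda>n. (1 / real n) ^ (if r \<ge> 1 then 2 * r + 3 else 4))"
  proof (rule bigoI[where c = B], use large in eventually_elim)
    case (elim n)
    then have eq: "\<Phi> - iter_mod_colloc_sol K (P n) (abs_linf f) = K (\<Phi> - Y n)" using iter[of n] by blast
    show ?case unfolding eq real_norm_def abs_norm_cancel pow using AB[of n] elim by blast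
  qed
  ultimately show ?thesis unfolding \<Phi>_def Y_def by blast
qed

end
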